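(* Let $G>0$ and $\rho>0$ be constants, let $z_0,z_1$ be real numbers with $-z_0<z_1$, and let $f:[-z_0,z_1]\to[0,\infty)$ be a (measurable) function. Let $$B=\{(s',\phi',z')\ \text{in cylindrical coordinates}:\ -z_0\le z'\le z_1,\ 0\le s'\le f(z'),\ 0\le\phi'\le 2\pi\}\subset\mathbb{R}^3$$ be the solid of revolution generated by revolving the graph of $f$ about the $z$-axis, with constant mass density $\rho$. For every point $\vec r\in\mathbb{R}^3$, with cylindrical coordinates $(s,\phi,z)$ (where $s\ge0$, $z\in\mathbb{R}$), the gravitational potential $$U_{\rm G}(\vec r)=-G\int_{B}\frac{\rho\,d^3\vec r\,'}{|\vec r-\vec r\,'|}$$ exerted by the body at $\vec r$ is given by $$U_{\rm G}(\vec r)=-2\pi G\rho\int_{-z_0}^{z_1} f(z')\,\mathbf{Y}\big(f(z'),s,|z-z'|\big)\,dz',$$ where $\mathbf{Y}$ is the explicit combination of complete elliptic integrals defined in the context.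
   Context: Cylindrical coordinates $(s,\phi,z)$ in $\mathbb{R}^3$: $s\ge0$ is the distance to the $z$-axis, $\phi$ the azimuthal angle, $z$ the axial coordinate. Complete elliptic integrals (argument $\kappa$ is the modulus): $$\mathbf{K}(\kappa)=\int_0^1\frac{dt}{\sqrt{1-t^2}\sqrt{1-\kappa^2t^2}},\qquad \mathbf{E}(\kappa)=\int_0^1\frac{\sqrt{1-\kappa^2t^2}}{\sqrt{1-t^2}}\,dt,$$ $$\mathbf{\Pi}(\nu,\kappa)=\int_0^1\frac{dt}{(1-\nu t^2)\sqrt{1-t^2}\sqrt{1-\kappa^2t^2}}.$$ For $a>0$, $b\ge0$, $d\ge0$, put $R=\sqrt{d^2+(a+b)^2}$, $\kappa=\dfrac{2\sqrt{ab}}{R}$, $\nu=\dfrac{4ab}{(a+b)^2}$, and define $$\mathbf{Y}(a,b,d)=\frac{R}{\pi a}\mathbf{E}(\kappa)+\frac{a^2-b^2}{\pi a R}\mathbf{K}(\kappa)+\frac{d^2(a-b)}{\pi a(a+b)R}\mathbf{\Pi}(\nu,\kappa)-\frac{d}{a}\mathbf{\Theta}(a-b),$$ where $\mathbf{\Theta}$ is the unit step function: $\mathbf{\Theta}(x)=1$ for $x>0$, $\mathbf{\Theta}(x)=0$ for $x<0$, $\mathbf{\Theta}(0)=\tfrac12$. When $a=b$ the terms containing $\mathbf{K}$ and $\mathbf{\Pi}$ (which carry the factor $a-b=0$) are taken to be $0$. The product $a\,\mathbf{Y}(a,b,d)$ is taken to be $0$ when $a=0$. (This $\mathbf{Y}(a,b,d)$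 is the closed form of $\int_0^{\infty}\frac{J_1(ka)J_0(kb)}{k}e^{-kd}\,dk$, with $J_0,J_1$ Bessel functions of the first kind.) *)

theory Defs
  imports "HOL-Analysis.Analysis"
begin

definition elliptic_K :: "real \<Rightarrow> real" where
  "elliptic_K \<kappa> = (LBINT t=0..1. 1 / (sqrt (1 - t\<^sup>2) * sqrt (1 - \<kappa>\<^sup>2 * t\<^sup>2)))"

definition elliptic_E :: "real \<Rightarrow> real" where
  "elliptic_E \<kappa> = (LBINT t=0..1. sqrt (1 - \<kappa>\<^sup>2 * t\<^sup>2) / sqrt (1 - t\<^sup>2))"

definition elliptic_Pi :: "real \<Rightarrow> real \<Rightarrow> real" where
  "elliptic_Pi \<nu> \<kappa> =
     (LBINT t=0..1. 1 / ((1 - \<nu> * t\<^sup>2) * sqrt (1 - t\<^sup>2) * sqrt (1 - \<kappa>\<^sup>2 * t\<^sup>2)))"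

definition unit_step :: "real \<Rightarrow> real" where
  "unit_step x = (if x > 0 then 1 else if x < 0 then 0 else 1 / 2)"

(* For a = b > 0 the integral defining elliptic_Pi diverges (and so does that of elliptic_K
   if moreover d = 0).  The factor a - b is then 0, so both terms vanish
   whatever value the divergent integral is given. *)
definition Y_fun :: "real \<Rightarrow> real \<Rightarrow> real \<Rightarrow> real" where
  "Y_fun a b d =
     (let R = sqrt (d\<^sup>2 + (a + b)\<^sup>2);
          \<kappa> = 2 * sqrt (a * b) / R;
          \<nu> = 4 * a * b / (a + b)\<^sup>2
      in R / (pi * a) * elliptic_E \<kappa>
         + (a\<^sup>2 - b\<^sup>2) / (pi * a * R) * elliptic_K \<kappa>
         + d\<^sup>2 * (a - b) / (pi * a * (a + b) * R) * elliptic_Pi \<nu> \<kappa>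
         - d / a * unit_step (a - b))"

definition cyl :: "real \<Rightarrow> real \<Rightarrow> real \<Rightarrow> real ^ 3" where
  "cyl s \<phi> z = vector [s * cos \<phi>, s * sin \<phi>, z]"

lemma cyl_exists:
  fixes r :: "real ^ 3"
  shows "\<exists>s \<phi> z. 0 \<le> s \<and> 0 \<le> \<phi> \<and> \<phi> < 2 * pi \<and> r = cyl s \<phi> z"
proof -
  define c where "c = Complex (r $ 1) (r $ 2)"
  obtain \<phi> where \<phi>: "0 \<le> \<phi>" "\<phi> < 2 * pi" "c = rcis (norm c) \<phi>"
    using Arg2pi[of c] by (auto simp: rcis_def cis_conv_exp is_Arg_def)
  have "r $ 1 = norm c * cos \<phi>" "r $ 2 = norm c * sin \<phi>"
    using arg_cong[OF \<phi>(3), of Re] arg_cong[OF \<phi>(3), of Im] by (simp_all add: c_def)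
  then have "r = cyl (norm c) \<phi> (r $ 3)"
    by (simp add: cyl_def vec_eq_iff forall_3)
  with \<phi> show ?thesis by (meson norm_ge_zero)
qed

definition solid_of_revolution :: "real \<Rightarrow> real \<Rightarrow> (real \<Rightarrow> real) \<Rightarrow> (real ^ 3) set" where
  "solid_of_revolution z0 z1 f =
     {cyl s' \<phi>' z' | s' \<phi>' z'. - z0 \<le> z' \<and> z' \<le> z1 \<and> 0 \<le> s' \<and> s' \<le> f z' \<and> 0 \<le> \<phi>' \<and> \<phi>' \<le> 2 * pi}"

(* The point r' = r, where the integrand is singular (and 0 by convention), is a null set. *)
definition grav_potential :: "real \<Rightarrow> real \<Rightarrow> (real ^ 3) set \<Rightarrow> real ^ 3 \<Rightarrow> real" where
  "grav_potential G \<rho> B r = - G * (LINT r':B|lebesgue. \<rho> / norm (r - r'))"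

end

theory Submission
  imports Defs
begin

text \<open>
  In cylindrical coordinates about the azimuth of \<open>r\<close> the potential becomes an integral over
  horizontal disks. The potential of a disk at height distance \<open>d > 0\<close> is the integral of the
  divergence of \<open>(y - x) / (sqrt (d\<^sup>2 + \<bar>y - x\<bar>\<^sup>2) + d)\<close>, a smooth field even when the foot point
  \<open>x\<close> lies in the disk or on its rim, so it equals a rim integral. Expanding the rim
  integrand by partial fractions in \<open>q = \<bar>y - x\<bar>\<^sup>2\<close> yields \<open>E\<close>, \<open>K\<close>, \<open>\<Pi>\<close>, and a Poisson kernel
  integral, which produces the step function. The one slice with \<open>d = 0\<close> is negligible, and
  nonnegative (Tonelli) integrals give integrability and value at once.
\<close>

subsection \<open>The elliptic integrals in trigonometric form\<close>

text \<open>The field is the radial one about \<open>x\<close> whose flux through the circle of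
  radius \<open>p\<close> around \<open>x\<close> is the integral of
  \<open>1 / sqrt (d\<^sup>2 + q)\<close> over the enclosed disk, namely
  \<open>2 * pi * (sqrt (d\<^sup>2 + p\<^sup>2) - d)\<close>. Its factor
  \<open>(sqrt (d\<^sup>2 + q) - d) / q\<close> is rationalised to
  \<open>1 / (sqrt (d\<^sup>2 + q) + d)\<close>: subtracting \<open>d\<close> is what removes the
  pole at \<open>x\<close>, so one rim formula serves foot points inside, on and outside the rim.
  Undoing the rationalisation on the rim brings \<open>1 / q\<close> back, and its integral jumps as
  the foot point crosses the rim.

  Two obstacles shape the rest. As \<open>f\<close> is only measurable, the potential may be
  infinite, so the change of variables has to hold for integrals with values in [0, infinity]. And
  measurability of the slice values is not read off the elliptic formula: they agree almost
  everywhere with an inner Tonelli integral of a Borel kernel, once \<open>f\<close> is replaced by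
  a Borel function.\<close>

lemma integral_cos_quarter:
  fixes G :: "real \<Rightarrow> real"
  assumes G: "continuous_on {-1..1} G"
  shows "((\<lambda>t. G (cos t)) has_integral 4 * integral {0..pi/2} (\<lambda>x. G (2 * (sin x)\<^sup>2 - 1))) {0..2*pi}"
proof -
  define J where "J = integral {0..pi/2} (\<lambda>x. G (2 * (sin x)\<^sup>2 - 1))"
  have rng: "2 * (sin x)\<^sup>2 - 1 \<in> {-1..1}" for x :: real
    using sin_squared_eq[of x] by (auto simp: abs_square_le_1)
  have "continuous_on {0..pi/2} (\<lambda>x. G (2 * (sin x)\<^sup>2 - 1))"
    by (rule continuous_on_compose2[OF G]) (use rng in \<open>auto intro!: continuous_intros\<close>)
  then have J: "((\<lambda>x. G (2 * (sin x)\<^sup>2 - 1)) has_integral J) {0..pi/2}"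
    unfolding J_def by (intro integrable_integral integrable_continuous_real)
  \<comment> \<open>The substitution is \<open>t = pi - 2 * x\<close>, for which
    \<open>cos t = - cos (2 * x) = 2 * (sin x)\<^sup>2 - 1\<close>.\<close>
  have eq1: "G (2 * (sin ((-1/2) * t + pi/2))\<^sup>2 - 1) = G (cos t)" for t
  proof -
    have "sin ((-1/2) * t + pi/2) = cos (t/2)"
      by (simp add: sin_diff)
    then show ?thesis using cos_double_cos[of "t/2"] by simp
  qed
  have "((\<lambda>t. G (2 * (sin ((-1/2) *\<^sub>R t + pi/2))\<^sup>2 - 1)) has_integral (1 / \<bar>-1/2\<bar> ^ DIM(real)) *\<^sub>R J)
     ((\<lambda>x. (1 / (-1/2)) *\<^sub>R x + - ((1 / (-1/2)) *\<^sub>R (pi/2))) ` cbox 0 (pi/2))"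
    by (rule has_integral_affinity) (use J in auto)
  moreover have "(\<lambda>x. (1 / (-1/2)) *\<^sub>R x + - ((1 / (-1/2)) *\<^sub>R (pi/2))) ` cbox 0 (pi/2) = {0..pi}"
  proof -
    have "x \<in> (\<lambda>x. (1 / (-1/2)) *\<^sub>R x + - ((1 / (-1/2)) *\<^sub>R (pi/2))) ` cbox 0 (pi/2)" if "x \<in> {0..pi}" for x
      by (rule image_eqI[of _ _ "(pi - x)/2"]) (use that in \<open>auto simp: field_simps\<close>)
    then show ?thesis by auto
  qed
  ultimately have h1: "((\<lambda>t. G (cos t)) has_integral 2 * J) {0..pi}"
    using eq1 by simp
  \<comment> \<open>The reflection \<open>t\<close> to \<open>2 * pi - t\<close> carries the second
    half of the period onto the first.\<close>
  have "((\<lambda>t. G (cos ((-1) *\<^sub>R t + 2 * pi))) has_integral (1 / \<bar>-1\<bar> ^ DIM(real)) *\<^sub>R (2 * J))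
     ((\<lambda>x. (1 / (-1)) *\<^sub>R x + - ((1 / (-1)) *\<^sub>R (2 * pi))) ` cbox 0 pi)"
    by (rule has_integral_affinity) (use h1 in auto)
  moreover have "(\<lambda>x. (1 / (-1)) *\<^sub>R x + - ((1 / (-1)) *\<^sub>R (2 * pi))) ` cbox 0 pi = {pi..2*pi}"
  proof -
    have "x \<in> (\<lambda>x. (1 / (-1)) *\<^sub>R x + - ((1 / (-1)) *\<^sub>R (2 * pi))) ` cbox 0 pi" if "x \<in> {pi..2*pi}" for x
      by (rule image_eqI[of _ _ "2*pi - x"]) (use that in \<open>auto simp: field_simps\<close>)
    then show ?thesis by auto
  qed
  ultimately have h2: "((\<lambda>t. G (cos t)) has_integral 2 * J) {pi..2*pi}"
    by (simp add: cos_diff)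
  show ?thesis
    using has_integral_combine[OF _ _ h1 h2] by (simp add: J_def)
qed

text \<open>Substituting \<open>t = sin x\<close> cancels the weight against \<open>cos x\<close>.
  The weight is unbounded at \<open>t = 1\<close>, hence the substitution rule for improper
  integrals of nonnegative functions, which asks for continuity of the integrand only in the open
  interval.\<close>

lemma LBINT_over_sqrt_one_minus_square:
  fixes g :: "real \<Rightarrow> real"
  assumes g: "continuous_on {0..1} g" and nonneg: "\<And>t. t \<in> {0..1} \<Longrightarrow> 0 \<le> g t"
  shows "(LBINT t=0..1. g t / sqrt (1 - t\<^sup>2)) = integral {0..pi/2} (\<lambda>x. g (sin x))"
proof -
  have sin01: "sin x \<in> {0<..<1}" if "0 < x" "x < pi/2" for x
    using that sin_gt_zero[of x] sin_monotone_2pi[of x "pi/2"] by auto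
  have eq: "g (sin x) / sqrt (1 - (sin x)\<^sup>2) * cos x = g (sin x)" if "0 < x" "x < pi/2" for x
  proof -
    have "0 < cos x" using that by (intro cos_gt_zero) auto
    moreover from this have "sqrt (1 - (sin x)\<^sup>2) = cos x" by (simp add: cos_squared_eq[symmetric])
    ultimately show ?thesis by simp
  qed
  have cont: "continuous_on {0..pi/2} (\<lambda>x. g (sin x))"
    by (rule continuous_on_compose2[OF g]) (auto intro!: continuous_intros sin_ge_zero)
  then have si: "set_integrable lborel {0..pi/2} (\<lambda>x. g (sin x))"
    by (rule borel_integrable_atLeastAtMost')
  have ein: "einterval 0 (ereal (pi/2)) = {0<..<pi/2}"
    by (auto simp: einterval_def)
  have "set_integrable lborel {0<..<pi/2} (\<lambda>x. g (sin x))"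
    by (rule set_integrable_subset[OF si]) auto
  then have fg: "set_integrable lborel (einterval 0 (ereal (pi/2))) (\<lambda>x. g (sin x) / sqrt (1 - (sin x)\<^sup>2) * cos x)"
    unfolding ein by (subst set_integrable_cong[OF refl refl eq]) simp_all
  have "(LBINT t=0..1. g t / sqrt (1 - t\<^sup>2))
      = (LBINT x=0..ereal (pi/2). g (sin x) / sqrt (1 - (sin x)\<^sup>2) * cos x)"
  proof (rule interval_integral_substitution_nonneg(2)[where g = sin and g' = cos])
    show "isCont (\<lambda>t. g t / sqrt (1 - t\<^sup>2)) (sin x)" if "0 < ereal x" "ereal x < ereal (pi/2)" for x
    proof -
      from sin01[of x] that have s: "sin x \<in> {0<..<1}" by auto
      then have "isCont g (sin x)"
        using continuous_on_interior[OF g, of "sin x"] by auto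
      moreover have "1 - (sin x)\<^sup>2 \<noteq> 0"
        using s by (auto simp: power2_eq_1_iff)
      ultimately show ?thesis by (auto intro!: continuous_intros)
    qed
    show "0 \<le> g (sin x) / sqrt (1 - (sin x)\<^sup>2)" if "0 < ereal x" "ereal x < ereal (pi/2)" for x
      using sin01[of x] that nonneg[of "sin x"] by (auto simp: abs_square_le_1)
    show "0 \<le> cos x" if "0 \<le> ereal x" "ereal x \<le> ereal (pi/2)" for x
      using that by (intro cos_ge_zero) auto
    have "(sin \<longlongrightarrow> sin 0) (at_right (0::real))" "(sin \<longlongrightarrow> sin (pi/2)) (at_left (pi/2))"
      by (intro tendsto_intros)+
    then show "((ereal \<circ> sin \<circ> real_of_ereal) \<longlongrightarrow> 0) (at_right 0)"
       "((ereal \<circ> sin \<circ> real_of_ereal) \<longlongrightarrow> 1) (at_left (ereal (pi/2)))"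
      by (simp_all add: zero_ereal_def one_ereal_def ereal_tendsto_simps)
  qed (use fg in \<open>auto intro: derivative_eq_intros\<close>)
  also have "\<dots> = (LBINT x=ereal 0..ereal (pi/2). g (sin x))"
    unfolding zero_ereal_def
    by (rule interval_lebesgue_integral_cong, simp, rule eq) (auto simp: einterval_def)
  also have "\<dots> = integral {0..pi/2} (\<lambda>x. g (sin x))"
    by (rule interval_integral_eq_integral) (use si in auto)
  finally show ?thesis .
qed

subsection \<open>The potential of a disk as a rim integral\<close>

lemma law_of_cosines_pos:
  fixes a b :: real
  assumes "0 \<le> a" "0 \<le> b" "a \<noteq> b"
  shows "0 < a\<^sup>2 + b\<^sup>2 - 2*a*b * cos t"
proof -
  have "a*b * cos t \<le> a*b*1" using assms by (intro mult_left_mono) auto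
  moreover have "0 < (a-b)\<^sup>2" using assms by simp
  ultimately show ?thesis by (simp add: power2_diff)
qed

lemma law_of_cosines_nonneg:
  fixes a b :: real
  shows "0 \<le> a\<^sup>2 + b\<^sup>2 - 2*a*b * cos t"
proof -
  have "a\<^sup>2 + b\<^sup>2 - 2*a*b * cos t = (a - b * cos t)\<^sup>2 + (b * sin t)\<^sup>2"
    by (simp add: power2_diff power_mult_distrib sin_squared_eq algebra_simps)
  then show ?thesis by simp
qed

text \<open>Times \<open>a\<^sup>2 - b\<^sup>2\<close>, the integrand is the real part of (a + w) /
  (a - w) with w = b exp(it), and a primitive of that is t - 2 arg(a - w). Since
  \<open>b < a\<close>, the real part of a - w is positive, so the \<open>arctan\<close> in
  \<open>F\<close> is a continuous branch of -arg on the whole period. It vanishes at both ends, and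
  only the summand \<open>t\<close> contributes.\<close>

lemma poisson_integral_less:
  fixes a b :: real
  assumes "0 \<le> b" "b < a"
  shows "((\<lambda>t. 1 / (a\<^sup>2 + b\<^sup>2 - 2*a*b * cos t)) has_integral 2*pi / (a\<^sup>2 - b\<^sup>2)) {0..2*pi}"
proof -
  define F where "F t = (t + 2 * arctan (b * sin t / (a - b * cos t))) / (a\<^sup>2 - b\<^sup>2)" for t
  have ab: "a\<^sup>2 - b\<^sup>2 > 0" using assms by (simp add: power_strict_mono)
  have pos: "a - b * cos t > 0" for t
  proof -
    have "b * cos t \<le> b * 1" using assms by (intro mult_left_mono) auto
    then show ?thesis using assms by simp
  qed
  have "(F has_real_derivative 1 / (a\<^sup>2 + b\<^sup>2 - 2*a*b * cos t)) (at t)" for t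
  proof -
    define p where "p = a - b * cos t"
    define q where "q = a\<^sup>2 + b\<^sup>2 - 2*a*b * cos t"
    have p: "p > 0" using pos by (simp add: p_def)
    have q: "q > 0" using law_of_cosines_pos[of a b] assms by (simp add: q_def)
    have qeq: "q = p\<^sup>2 + (b * sin t)\<^sup>2"
      by (simp add: p_def q_def power2_diff power_mult_distrib sin_squared_eq algebra_simps)
    have "1 + 2 * (inverse (1 + (b * sin t / p)\<^sup>2) * ((b * cos t * p - b * sin t * (b * sin t)) / (p * p)))
        = (a\<^sup>2 - b\<^sup>2) / q"
    proof -
      have "inverse (1 + (b * sin t / p)\<^sup>2) = p\<^sup>2 / q"
        using p q by (simp add: qeq power_divide field_simps)
      moreover have "b * cos t * p - b * sin t * (b * sin t) = a * b * cos t - b\<^sup>2"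
        by (simp add: p_def algebra_simps flip: power2_eq_square)
           (simp add: power2_eq_square[symmetric] sin_squared_eq algebra_simps)
      ultimately have "1 + 2 * (inverse (1 + (b * sin t / p)\<^sup>2) * ((b * cos t * p - b * sin t * (b * sin t)) / (p * p)))
         = 1 + 2 * (a * b * cos t - b\<^sup>2) / q"
        using p by (simp add: power2_eq_square)
      also have "\<dots> = (q + 2 * (a * b * cos t - b\<^sup>2)) / q"
        using q by (simp add: add_divide_distrib)
      also have "q + 2 * (a * b * cos t - b\<^sup>2) = a\<^sup>2 - b\<^sup>2"
        by (simp add: q_def algebra_simps)
      finally show ?thesis .
    qed
    moreover have "(F has_real_derivative (1 + 2 * (inverse (1 + (b * sin t / p)\<^sup>2) * ((b * cos t * p - b * sin t * (b * sin t)) / (p * p)))) / (a\<^sup>2 - b\<^sup>2)) (at t)"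
      unfolding F_def using p ab unfolding p_def
      by (auto intro!: derivative_eq_intros)
    ultimately show ?thesis using ab by (simp add: q_def)
  qed
  then have "((\<lambda>t. 1 / (a\<^sup>2 + b\<^sup>2 - 2*a*b * cos t)) has_integral F (2*pi) - F 0) {0..2*pi}"
    by (intro fundamental_theorem_of_calculus)
       (auto simp: has_real_derivative_iff_has_vector_derivative intro: has_vector_derivative_at_within)
  then show ?thesis by (simp add: F_def)
qed

lemma poisson_integral:
  fixes a b :: real
  assumes "0 \<le> a" "0 \<le> b" "a \<noteq> b"
  shows "((\<lambda>t. 1 / (a\<^sup>2 + b\<^sup>2 - 2*a*b * cos t)) has_integral 2*pi / \<bar>a\<^sup>2 - b\<^sup>2\<bar>) {0..2*pi}"
proof (cases "b < a")
  case True
  then have "\<bar>a\<^sup>2 - b\<^sup>2\<bar> = a\<^sup>2 - b\<^sup>2" using assms by (simp add: power_mono)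
  then show ?thesis using poisson_integral_less[of b a] assms True by simp
next
  case False
  then have "\<bar>a\<^sup>2 - b\<^sup>2\<bar> = b\<^sup>2 - a\<^sup>2" using assms by (simp add: power_mono)
  then show ?thesis using poisson_integral_less[of a b] assms False by (simp add: ac_simps)
qed

text \<open>The flux of the field through the rim, with the foot point at distance \<open>b\<close>
  in direction 0: the outward normal component has numerator \<open>a - b * cos t\<close>, and the
  arc length element supplies the further factor \<open>a\<close>.\<close>

definition rim_integral :: "real \<Rightarrow> real \<Rightarrow> real \<Rightarrow> real" where
  "rim_integral a b d = integral {0..2*pi}
     (\<lambda>t. (a\<^sup>2 - a*b * cos t) / (sqrt (d\<^sup>2 + (a\<^sup>2 + b\<^sup>2 - 2*a*b * cos t)) + d))"

text \<open>This is \<open>r\<close> times the divergence in polar coordinates about the centre of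
  the disk, not about the foot point: the first summand is the \<open>r\<close>-derivative of
  \<open>r\<close> times the radial component, the second the \<open>t\<close>-derivative of the
  angular component. The sum collapses because the squared distance to the foot point is
  \<open>S\<^sup>2 - d\<^sup>2 = (S - d) * (S + d)\<close>.\<close>

lemma divergence_polar:
  fixes r b d S t :: real
  assumes S: "S\<^sup>2 = d\<^sup>2 + (r\<^sup>2 + b\<^sup>2 - 2*r*b * cos t)" "S > 0" "d > 0"
  shows "((2*r - b * cos t) * (S + d) - (r\<^sup>2 - r*b * cos t) * ((r - b * cos t) / S)) / (S + d)\<^sup>2
    + (b * cos t * (S + d) - b * sin t * (r*b * sin t / S)) / (S + d)\<^sup>2 = r / S"
proof -
  have nz: "S + d > 0" using assms by simp
  have sc: "(sin t)\<^sup>2 = 1 - (cos t)\<^sup>2" by (simp add: sin_squared_eq)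
  have "((2*r - b * cos t) * (S + d) - (r\<^sup>2 - r*b * cos t) * ((r - b * cos t) / S))
    + (b * cos t * (S + d) - b * sin t * (r*b * sin t / S)) =
    r * (2 * S * (S + d) - ((r - b * cos t)\<^sup>2 + b\<^sup>2 * (sin t)\<^sup>2)) / S"
    using S(2) by (simp add: field_simps power2_eq_square)
  also have "(r - b * cos t)\<^sup>2 + b\<^sup>2 * (sin t)\<^sup>2 = S\<^sup>2 - d\<^sup>2"
    by (simp add: S(1) sc power2_diff power_mult_distrib algebra_simps)
  also have "2 * S * (S + d) - (S\<^sup>2 - d\<^sup>2) = (S + d)\<^sup>2"
    by (simp add: power2_eq_square algebra_simps)
  finally show ?thesis using nz by (simp add: add_divide_distrib[symmetric])
qed

lemma disk_integral_eq_rim_integral: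
  fixes a b d :: real
  assumes a: "0 \<le> a" and d: "0 < d"
  shows "((\<lambda>r. integral {0..2*pi} (\<lambda>t. r / sqrt (d\<^sup>2 + (r\<^sup>2 + b\<^sup>2 - 2*r*b * cos t))))
     has_integral rim_integral a b d) {0..a}"
proof -
  define S where "S r t = sqrt (d\<^sup>2 + (r\<^sup>2 + b\<^sup>2 - 2*r*b * cos t))" for r t
  have pos: "d\<^sup>2 + (r\<^sup>2 + b\<^sup>2 - 2*r*b * cos t) > 0" for r t
    using law_of_cosines_nonneg[of r b t] d by (simp add: add_pos_nonneg)
  have S: "S r t > 0" "(S r t)\<^sup>2 = d\<^sup>2 + (r\<^sup>2 + b\<^sup>2 - 2*r*b * cos t)" for r t
    using pos[of r t] by (simp_all add: S_def less_imp_le)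
  have contS: "continuous_on X (\<lambda>x. S (f x) (g x))" if "continuous_on X f" "continuous_on X g"
    for X :: "'x::t2_space set" and f g
    unfolding S_def by (intro continuous_intros that)
  define u where "u r t = ((2*r - b * cos t) * (S r t + d) - (r\<^sup>2 - r*b * cos t) * ((r - b * cos t) / S r t)) / (S r t + d)\<^sup>2" for r t
  define v where "v r t = (b * cos t * (S r t + d) - b * sin t * (r*b * sin t / S r t)) / (S r t + d)\<^sup>2" for r t
  have nz: "S r t \<noteq> 0" "S r t + d \<noteq> 0" "S r t + d > 0" for r t using S(1)[of r t] d by auto
  have uv: "u r t + v r t = r / S r t" for r t
    unfolding u_def v_def by (rule divergence_polar[OF S(2,1) d])
  have dS: "((\<lambda>r. S r t) has_real_derivative (r - b * cos t) / S r t) (at r)"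
     "((\<lambda>t. S r t) has_real_derivative r*b * sin t / S r t) (at t)" for r t
    using pos[of r t] unfolding S_def
    by (auto intro!: derivative_eq_intros simp: field_simps)
  have du: "((\<lambda>r. (r\<^sup>2 - r*b * cos t) / (S r t + d)) has_real_derivative u r t) (at r)" for r t
    using nz[of r t] unfolding u_def
    by (auto intro!: derivative_eq_intros dS simp: power2_eq_square)
  have dv: "((\<lambda>t. b * sin t / (S r t + d)) has_real_derivative v r t) (at t)" for r t
    using nz[of r t] unfolding v_def
    by (auto intro!: derivative_eq_intros dS simp: power2_eq_square)
  have contu: "continuous_on X (\<lambda>x. u (f x) (g x))" if "continuous_on X f" "continuous_on X g"
    for X :: "'x::t2_space set" and f g
    unfolding u_def by (intro continuous_intros contS that) (use nz in auto)
  have contv: "continuous_on X (\<lambda>x. v (f x) (g x))" if "continuous_on X f" "continuous_on X g"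
    for X :: "'x::t2_space set" and f g
    unfolding v_def by (intro continuous_intros contS that) (use nz in auto)
  \<comment> \<open>The angular component is periodic in \<open>t\<close>, so it has no net effect
    over a full circle.\<close>
  have int_v: "integral {0..2*pi} (v r) = 0" for r
  proof -
    have "(v r has_integral b * sin (2*pi) / (S r (2*pi) + d) - b * sin 0 / (S r 0 + d)) {0..2*pi}"
      by (intro fundamental_theorem_of_calculus)
       (auto simp: has_real_derivative_iff_has_vector_derivative[symmetric]
         intro: has_field_derivative_at_within dv)
    then show ?thesis by (simp add: integral_unique)
  qed
  \<comment> \<open>The radial term carries a factor \<open>r\<close>, so its value at the centre is
    0 and only the rim survives.\<close>
  have int_u: "integral {0..a} (\<lambda>r. u r t) = (a\<^sup>2 - a*b * cos t) / (S a t + d)" for t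
  proof -
    have "((\<lambda>r. u r t) has_integral (a\<^sup>2 - a*b * cos t) / (S a t + d) - (0\<^sup>2 - 0*b * cos t) / (S 0 t + d)) {0..a}"
      by (intro fundamental_theorem_of_calculus a)
       (auto simp: has_real_derivative_iff_has_vector_derivative[symmetric]
         intro: has_field_derivative_at_within du)
    then show ?thesis by (simp add: integral_unique)
  qed
  have inner: "integral {0..2*pi} (\<lambda>t. r / S r t) = integral {0..2*pi} (u r)" for r
  proof -
    have "integral {0..2*pi} (\<lambda>t. u r t + v r t) = integral {0..2*pi} (u r) + integral {0..2*pi} (v r)"
      by (intro integral_add integrable_continuous_real contu contv continuous_intros)
    then show ?thesis using uv int_v by simp
  qed
  have "integral {0..a} (\<lambda>r. integral {0..2*pi} (u r)) = integral {0..2*pi} (\<lambda>t. integral {0..a} (\<lambda>r. u r t))"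
    using integral_swap_continuous[of 0 0 a "2*pi" u]
    by (simp add: case_prod_unfold contu continuous_intros)
  also have "\<dots> = rim_integral a b d"
    by (simp add: int_u rim_integral_def S_def)
  finally have "integral {0..a} (\<lambda>r. integral {0..2*pi} (u r)) = rim_integral a b d" .
  moreover have "(\<lambda>r. integral {0..2*pi} (u r)) integrable_on {0..a}"
    using integral_integrable_2dim[of 0 0 a "2*pi" "\<lambda>p. u (fst p) (snd p)"]
    by (simp add: contu continuous_intros)
  ultimately show ?thesis
    using inner by (simp add: has_integral_iff S_def)
qed

subsection \<open>The rim integral in terms of elliptic integrals\<close>

text \<open>The bounds on \<open>\<kappa>\<close> and \<open>\<nu>\<close> keep the remaining factor
  continuous up to \<open>t = 1\<close>; then \<open>1 / sqrt (1 - t\<^sup>2)\<close> is the only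
  singular factor and \<open>t = sin x\<close> removes it.\<close>

lemma
  fixes \<kappa> :: real
  assumes \<kappa>: "\<kappa>\<^sup>2 < 1"
  shows elliptic_E_trig: "elliptic_E \<kappa> = integral {0..pi/2} (\<lambda>x. sqrt (1 - \<kappa>\<^sup>2 * (sin x)\<^sup>2))"
    and elliptic_K_trig: "elliptic_K \<kappa> = integral {0..pi/2} (\<lambda>x. 1 / sqrt (1 - \<kappa>\<^sup>2 * (sin x)\<^sup>2))"
    and elliptic_Pi_trig: "\<nu> < 1 \<Longrightarrow> 0 \<le> \<nu> \<Longrightarrow> elliptic_Pi \<nu> \<kappa>
      = integral {0..pi/2} (\<lambda>x. 1 / ((1 - \<nu> * (sin x)\<^sup>2) * sqrt (1 - \<kappa>\<^sup>2 * (sin x)\<^sup>2)))"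
proof -
  have pos: "1 - c * t\<^sup>2 > 0" if "t \<in> {0..1}" "c < 1" "0 \<le> c" for c t :: real
  proof -
    have "c * t\<^sup>2 \<le> c * 1" using that by (intro mult_left_mono) (auto simp: power_le_one)
    then show ?thesis using that by simp
  qed
  note p\<kappa> = pos[OF _ \<kappa> zero_le_power2]
  have nz\<kappa>: "1 - \<kappa>\<^sup>2 * t\<^sup>2 \<noteq> 0" "0 \<le> 1 - \<kappa>\<^sup>2 * t\<^sup>2" if "t \<in> {0..1}" for t
    using p\<kappa>[OF that] by auto
  show "elliptic_E \<kappa> = integral {0..pi/2} (\<lambda>x. sqrt (1 - \<kappa>\<^sup>2 * (sin x)\<^sup>2))"
    unfolding elliptic_E_def
    by (rule LBINT_over_sqrt_one_minus_square[of "\<lambda>t. sqrt (1 - \<kappa>\<^sup>2 * t\<^sup>2)"])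
       (use nz\<kappa> in \<open>auto intro!: continuous_intros\<close>)
  have "(LBINT t=0..1. (1 / sqrt (1 - \<kappa>\<^sup>2 * t\<^sup>2)) / sqrt (1 - t\<^sup>2))
    = integral {0..pi/2} (\<lambda>x. 1 / sqrt (1 - \<kappa>\<^sup>2 * (sin x)\<^sup>2))"
    by (rule LBINT_over_sqrt_one_minus_square[of "\<lambda>t. 1 / sqrt (1 - \<kappa>\<^sup>2 * t\<^sup>2)"])
       (use nz\<kappa> in \<open>auto intro!: continuous_intros\<close>)
  then show "elliptic_K \<kappa> = integral {0..pi/2} (\<lambda>x. 1 / sqrt (1 - \<kappa>\<^sup>2 * (sin x)\<^sup>2))"
    by (simp add: elliptic_K_def mult.commute)
  assume \<nu>: "\<nu> < 1" "0 \<le> \<nu>"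
  have nz\<nu>: "1 - \<nu> * t\<^sup>2 \<noteq> 0" "0 \<le> 1 - \<nu> * t\<^sup>2" if "t \<in> {0..1}" for t
    using pos[OF that \<nu>] by auto
  have "(LBINT t=0..1. (1 / ((1 - \<nu> * t\<^sup>2) * sqrt (1 - \<kappa>\<^sup>2 * t\<^sup>2))) / sqrt (1 - t\<^sup>2))
    = integral {0..pi/2} (\<lambda>x. 1 / ((1 - \<nu> * (sin x)\<^sup>2) * sqrt (1 - \<kappa>\<^sup>2 * (sin x)\<^sup>2)))"
    by (rule LBINT_over_sqrt_one_minus_square[of "\<lambda>t. 1 / ((1 - \<nu> * t\<^sup>2) * sqrt (1 - \<kappa>\<^sup>2 * t\<^sup>2))"])
       (use nz\<kappa> nz\<nu> in \<open>auto intro!: continuous_intros\<close>)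
  then show "elliptic_Pi \<nu> \<kappa>
      = integral {0..pi/2} (\<lambda>x. 1 / ((1 - \<nu> * (sin x)\<^sup>2) * sqrt (1 - \<kappa>\<^sup>2 * (sin x)\<^sup>2)))"
    by (simp add: elliptic_Pi_def mult_ac)
qed

text \<open>The moduli come from \<open>cos t = 2 * (sin x)\<^sup>2 - 1\<close>, which makes
  \<open>q\<close> equal to \<open>(a + b)\<^sup>2 - 4 * a * b * (sin x)\<^sup>2\<close>. Pulling
  out the value at \<open>x = 0\<close> gives
  \<open>q = (a + b)\<^sup>2 * (1 - \<nu> * (sin x)\<^sup>2)\<close> and \<open>d\<^sup>2 + q =
  R\<^sup>2 * (1 - \<kappa>\<^sup>2 * (sin x)\<^sup>2)\<close>.\<close>

lemma
  fixes a b d :: real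
  defines "R \<equiv> sqrt (d\<^sup>2 + (a + b)\<^sup>2)"
  defines "\<kappa> \<equiv> 2 * sqrt (a * b) / R"
  defines "\<nu> \<equiv> 4 * a * b / (a + b)\<^sup>2"
  defines "q \<equiv> (\<lambda>t. a\<^sup>2 + b\<^sup>2 - 2 * a * b * cos t)"
  assumes a: "0 < a" and b: "0 \<le> b" and d: "0 < d"
  shows rim_E: "((\<lambda>t. sqrt (d\<^sup>2 + q t)) has_integral 4 * R * elliptic_E \<kappa>) {0..2*pi}"
    and rim_K: "((\<lambda>t. 1 / sqrt (d\<^sup>2 + q t)) has_integral 4 / R * elliptic_K \<kappa>) {0..2*pi}"
    and rim_Pi: "a \<noteq> b \<Longrightarrow> ((\<lambda>t. 1 / (q t * sqrt (d\<^sup>2 + q t)))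
           has_integral 4 / ((a + b)\<^sup>2 * R) * elliptic_Pi \<nu> \<kappa>) {0..2*pi}"
proof -
  have R2: "R\<^sup>2 = d\<^sup>2 + (a + b)\<^sup>2" and R: "R > 0"
    using a b d by (auto simp: R_def add_pos_nonneg)
  have \<kappa>2: "\<kappa>\<^sup>2 = 4 * a * b / R\<^sup>2"
    using a b by (simp add: \<kappa>_def power_divide power_mult_distrib)
  \<comment> \<open>Positivity of \<open>d\<close> makes the inequality strict even when
    \<open>a = b\<close>.\<close>
  have \<kappa>: "\<kappa>\<^sup>2 < 1"
  proof -
    have "R\<^sup>2 - 4 * a * b = d\<^sup>2 + (a - b)\<^sup>2" unfolding R2 by (simp add: power2_eq_square algebra_simps)
    also have "\<dots> > 0" using d by (simp add: add_pos_nonneg)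
    finally show ?thesis unfolding \<kappa>2 using R by simp
  qed
  define Q where "Q c = a\<^sup>2 + b\<^sup>2 - 2 * a * b * c" for c
  have q: "q t = Q (cos t)" for t by (simp add: q_def Q_def)
  have Qnn: "Q c \<ge> 0" if "c \<in> {-1..1}" for c
    using law_of_cosines_nonneg[of a b "arccos c"] that by (simp add: Q_def)
  have dQ: "d\<^sup>2 + Q c > 0" if "c \<in> {-1..1}" for c
    using Qnn[OF that] d by (simp add: add_pos_nonneg)
  then have dQ': "sqrt (d\<^sup>2 + Q c) \<noteq> 0" if "c \<in> {-1..1}" for c using that by force
  have contQ: "continuous_on X Q" for X
    unfolding Q_def by (intro continuous_intros)
  have dQ2: "d\<^sup>2 + Q (2 * (sin x)\<^sup>2 - 1) = R\<^sup>2 * (1 - \<kappa>\<^sup>2 * (sin x)\<^sup>2)" for x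

  proof -
    have "R\<^sup>2 * (1 - \<kappa>\<^sup>2 * (sin x)\<^sup>2) = R\<^sup>2 - 4 * a * b * (sin x)\<^sup>2"
      unfolding \<kappa>2 using R by (simp add: algebra_simps)
    then show ?thesis unfolding R2 by (simp add: Q_def power2_eq_square algebra_simps)
  qed
  have S2: "sqrt (d\<^sup>2 + Q (2 * (sin x)\<^sup>2 - 1)) = R * sqrt (1 - \<kappa>\<^sup>2 * (sin x)\<^sup>2)" for x
    unfolding dQ2 using R by (simp add: real_sqrt_mult)
  have "((\<lambda>t. sqrt (d\<^sup>2 + Q (cos t))) has_integral 4 * integral {0..pi/2} (\<lambda>x. sqrt (d\<^sup>2 + Q (2 * (sin x)\<^sup>2 - 1)))) {0..2*pi}"
    by (intro integral_cos_quarter continuous_intros contQ)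
  then show "((\<lambda>t. sqrt (d\<^sup>2 + q t)) has_integral 4 * R * elliptic_E \<kappa>) {0..2*pi}"
    by (simp add: q S2 elliptic_E_trig[OF \<kappa>] mult.assoc)
  have "((\<lambda>t. 1 / sqrt (d\<^sup>2 + Q (cos t))) has_integral 4 * integral {0..pi/2} (\<lambda>x. 1 / sqrt (d\<^sup>2 + Q (2 * (sin x)\<^sup>2 - 1)))) {0..2*pi}"
    using dQ' by (intro integral_cos_quarter continuous_intros contQ) auto
  moreover have "integral {0..pi/2} (\<lambda>x. 1 / sqrt (d\<^sup>2 + Q (2 * (sin x)\<^sup>2 - 1))) = 1 / R * elliptic_K \<kappa>"
    unfolding S2 elliptic_K_trig[OF \<kappa>] integral_mult_right[symmetric]
    by simp
  ultimately show "((\<lambda>t. 1 / sqrt (d\<^sup>2 + q t)) has_integral 4 / R * elliptic_K \<kappa>) {0..2*pi}"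
    by (simp add: q)
  assume ne: "a \<noteq> b"
  have \<nu>: "\<nu> < 1" "0 \<le> \<nu>"
  proof -
    have "(a + b)\<^sup>2 - 4 * a * b = (a - b)\<^sup>2" by (simp add: power2_eq_square algebra_simps)
    also have "\<dots> > 0" using ne by simp
    finally show "\<nu> < 1" unfolding \<nu>_def using a b by simp
    show "0 \<le> \<nu>" unfolding \<nu>_def using a b by simp
  qed
  have Qnz: "Q c \<noteq> 0" if "c \<in> {-1..1}" for c
    using law_of_cosines_pos[of a b "arccos c"] that a b ne by (simp add: Q_def)
  have Q2: "Q (2 * (sin x)\<^sup>2 - 1) = (a + b)\<^sup>2 * (1 - \<nu> * (sin x)\<^sup>2)" for x
    unfolding \<nu>_def using a b by (simp add: algebra_simps) (simp add: Q_def power2_eq_square algebra_simps)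
  have "((\<lambda>t. 1 / (Q (cos t) * sqrt (d\<^sup>2 + Q (cos t)))) has_integral 4 * integral {0..pi/2}
     (\<lambda>x. 1 / (Q (2 * (sin x)\<^sup>2 - 1) * sqrt (d\<^sup>2 + Q (2 * (sin x)\<^sup>2 - 1))))) {0..2*pi}"
    using dQ' Qnz by (intro integral_cos_quarter continuous_intros contQ) auto
  moreover have "integral {0..pi/2} (\<lambda>x. 1 / (Q (2 * (sin x)\<^sup>2 - 1) * sqrt (d\<^sup>2 + Q (2 * (sin x)\<^sup>2 - 1))))
     = 1 / ((a + b)\<^sup>2 * R) * elliptic_Pi \<nu> \<kappa>"
    unfolding S2 unfolding Q2 elliptic_Pi_trig[OF \<kappa> \<nu>] integral_mult_right[symmetric]
    by (simp add: mult_ac)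
  ultimately show "((\<lambda>t. 1 / (q t * sqrt (d\<^sup>2 + q t)))
           has_integral 4 / ((a + b)\<^sup>2 * R) * elliptic_Pi \<nu> \<kappa>) {0..2*pi}"
    by (simp add: q)
qed

text \<open>The step function is assembled from two pieces: the constant \<open>- d / 2\<close>
  integrates to \<open>- pi * d\<close>, and the Poisson term to \<open>- pi * d\<close> times the
  sign of \<open>a\<^sup>2 - b\<^sup>2\<close>. Together they give
  \<open>- 2 * pi * d * unit_step (a - b)\<close>, also at \<open>a = b\<close>, where the second
  piece is absent.\<close>

lemma rim_integral_eq_Y_fun:
  fixes a b d :: real
  assumes a: "0 < a" and b: "0 \<le> b" and d: "0 < d"
  shows "rim_integral a b d = 2 * pi * (a * Y_fun a b d)"
proof -
  define R where "R = sqrt (d\<^sup>2 + (a + b)\<^sup>2)"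
  define \<kappa> where "\<kappa> = 2 * sqrt (a * b) / R"
  define \<nu> where "\<nu> = 4 * a * b / (a + b)\<^sup>2"
  define q where "q t = a\<^sup>2 + b\<^sup>2 - 2 * a * b * cos t" for t
  define S where "S t = sqrt (d\<^sup>2 + q t)" for t
  note * = rim_E[OF assms, folded R_def, folded \<kappa>_def, folded q_def, folded S_def]
     rim_K[OF assms, folded R_def, folded \<kappa>_def, folded q_def, folded S_def]
     rim_Pi[OF assms, folded R_def, folded \<kappa>_def \<nu>_def, folded q_def, folded S_def]
  have R: "R > 0" using a b d by (auto simp: R_def add_pos_nonneg)
  have qnn: "q t \<ge> 0" for t using law_of_cosines_nonneg[of a b t] by (simp add: q_def)
  have S: "S t > 0" "(S t)\<^sup>2 = d\<^sup>2 + q t" for t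
    using qnn[of t] d by (simp_all add: S_def add_pos_nonneg)
  have Sd: "S t + d > 0" "S t + d \<noteq> 0" for t using S(1)[of t] d by auto
  have rim: "rim_integral a b d = integral {0..2*pi} (\<lambda>t. (a\<^sup>2 - a * b * cos t) / (S t + d))"
    by (simp add: rim_integral_def S_def q_def)
  have num: "a\<^sup>2 - a * b * cos t = (q t + (a\<^sup>2 - b\<^sup>2)) / 2" for t
    by (simp add: q_def)
  have dif: "q t = (S t - d) * (S t + d)" for t
    using S(2)[of t] by (simp add: power2_eq_square algebra_simps)
  have Y: "a * Y_fun a b d = R / pi * elliptic_E \<kappa> + (a\<^sup>2 - b\<^sup>2) / (pi * R) * elliptic_K \<kappa>
     + d\<^sup>2 * (a - b) / (pi * (a + b) * R) * elliptic_Pi \<nu> \<kappa> - d * unit_step (a - b)"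
  proof -
    have "a * (R / (pi * a) * x + u / (pi * a * R) * y + v / (pi * a * w * R) * z - d / a * h)
      = R / pi * x + u / (pi * R) * y + v / (pi * w * R) * z - d * h" for x y z u v w h
      using a by (simp add: algebra_simps)
    then show ?thesis
      unfolding Y_fun_def Let_def R_def[symmetric] \<kappa>_def[symmetric] \<nu>_def[symmetric] .
  qed
  have const: "((\<lambda>t. d / 2) has_integral (2 * pi) * (d / 2)) {0..2*pi}"
    using has_integral_const_real[of "d / 2" 0 "2 * pi"] by simp
  show ?thesis
  proof (cases "a = b")
    case True
    \<comment> \<open>For \<open>a = b\<close> the function \<open>q\<close> vanishes at
      \<open>t = 0\<close>, so a division by \<open>q t\<close> must be avoided. The numerator is
      \<open>q t / 2\<close> here, and the factor \<open>S t + d\<close> of \<open>q t\<close>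
      cancels.\<close>
    have "(a\<^sup>2 - a * b * cos t) / (S t + d) = 1/2 * S t - d / 2" for t
      using Sd(2)[of t] unfolding num dif using True by (simp add: field_simps)
    moreover have "((\<lambda>t. 1/2 * S t - d / 2) has_integral 1/2 * (4 * R * elliptic_E \<kappa>) - (2 * pi) * (d / 2)) {0..2*pi}"
      by (intro has_integral_diff has_integral_mult_right *(1) const)
    ultimately have "rim_integral a b d = 2 * R * elliptic_E \<kappa> - pi * d"
      unfolding rim by (simp add: integral_unique)
    then show ?thesis unfolding Y using True by (simp add: unit_step_def algebra_simps)
  next
    case False
    have q: "q t > 0" for t using law_of_cosines_pos[of a b t] a b False by (simp add: q_def)
    define c where "c = a\<^sup>2 - b\<^sup>2"
    have "(a\<^sup>2 - a * b * cos t) / (S t + d)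
      = 1/2 * S t + c/2 * (1 / S t) + c * d\<^sup>2 / 2 * (1 / (q t * S t)) - (d/2 + c * d / 2 * (1 / q t))" for t
    proof -
      \<comment> \<open>Here \<open>1 / (S t + d)\<close> becomes \<open>(S t - d) / q t\<close>.
        The part \<open>S t / q t\<close> is then rewritten as
        \<open>(d\<^sup>2 + q t) / (q t * S t)\<close>, which splits into the integrands of
        \<open>K\<close> and \<open>\<Pi>\<close>.\<close>
      have "(a\<^sup>2 - a * b * cos t) / (S t + d) = (q t + c) * (S t - d) / (2 * q t)"
        using Sd(2)[of t] q[of t] unfolding num c_def by (simp add: dif field_simps)
      also have "\<dots> = 1/2 * (S t - d) + c * (S t - d) / (2 * q t)"
        using q[of t] by (simp add: field_simps)
      also have "c * (S t - d) / (2 * q t) = c / 2 * ((d\<^sup>2 + q t) / (q t * S t)) - c * d / 2 * (1 / q t)"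
        using q[of t] S(1)[of t] unfolding S(2)[symmetric] by (simp add: field_simps power2_eq_square)
      also have "(d\<^sup>2 + q t) / (q t * S t) = 1 / S t + d\<^sup>2 * (1 / (q t * S t))"
        using q[of t] S(1)[of t] by (simp add: field_simps)
      finally show ?thesis by (simp add: algebra_simps diff_divide_distrib)
    qed
    moreover have "((\<lambda>t. 1/2 * S t + c/2 * (1 / S t) + c * d\<^sup>2 / 2 * (1 / (q t * S t)) - (d/2 + c * d / 2 * (1 / q t))) has_integral
       1/2 * (4 * R * elliptic_E \<kappa>) + c/2 * (4 / R * elliptic_K \<kappa>) + c * d\<^sup>2 / 2 * (4 / ((a + b)\<^sup>2 * R) * elliptic_Pi \<nu> \<kappa>)
         - ((2 * pi) * (d / 2) + c * d / 2 * (2 * pi / \<bar>c\<bar>))) {0..2*pi}"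
      unfolding q_def c_def
      by (intro has_integral_diff has_integral_add has_integral_mult_right const
         *[unfolded q_def] poisson_integral) (use a b False in auto)
    ultimately have "((\<lambda>t. (a\<^sup>2 - a * b * cos t) / (S t + d)) has_integral 1/2 * (4 * R * elliptic_E \<kappa>) + c/2 * (4 / R * elliptic_K \<kappa>) + c * d\<^sup>2 / 2 * (4 / ((a + b)\<^sup>2 * R) * elliptic_Pi \<nu> \<kappa>)
         - ((2 * pi) * (d / 2) + c * d / 2 * (2 * pi / \<bar>c\<bar>))) {0..2*pi}"
      by (simp only:)
    then have "rim_integral a b d = 1/2 * (4 * R * elliptic_E \<kappa>) + c/2 * (4 / R * elliptic_K \<kappa>) + c * d\<^sup>2 / 2 * (4 / ((a + b)\<^sup>2 * R) * elliptic_Pi \<nu> \<kappa>)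
         - ((2 * pi) * (d / 2) + c * d / 2 * (2 * pi / \<bar>c\<bar>))"
      unfolding rim by (rule integral_unique)
    also have "\<dots> = 2 * R * elliptic_E \<kappa> + 2 * c / R * elliptic_K \<kappa>
       + 2 * (c * d\<^sup>2) / ((a + b)\<^sup>2 * R) * elliptic_Pi \<nu> \<kappa> - (pi * d + d * pi * (c / \<bar>c\<bar>))"
      by (simp add: algebra_simps)
    also have "c / \<bar>c\<bar> = 2 * unit_step (a - b) - 1"
    proof (cases "b < a")
      case True
      then have "c > 0" using a b by (simp add: c_def power_strict_mono)
      then show ?thesis using True by (simp add: unit_step_def)
    next
      case b_gt: False
      then have "c < 0" using a b False by (simp add: c_def power_strict_mono)
      then show ?thesis using b_gt False by (simp add: unit_step_def)
    qed
    also have "2 * (c * d\<^sup>2) / ((a + b)\<^sup>2 * R) = 2 * d\<^sup>2 * (a - b) / ((a + b) * R)"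
    proof -
      have c: "c = (a + b) * (a - b)" by (simp add: c_def power2_eq_square algebra_simps)
      have "2 * (w * m * D) / (w\<^sup>2 * R) = 2 * D * m / (w * R)" if "w > 0" for w m D :: real
        using that by (simp add: power2_eq_square)
      then show ?thesis unfolding c using a b by simp
    qed
    finally have rim_eq: "rim_integral a b d = 2 * R * elliptic_E \<kappa> + 2 * c / R * elliptic_K \<kappa>
       + 2 * d\<^sup>2 * (a - b) / ((a + b) * R) * elliptic_Pi \<nu> \<kappa> - (pi * d + d * pi * (2 * unit_step (a - b) - 1))" .
    have "2 * R * x + 2 * c / R * y + 2 * D * m / (w * R) * z - (pi * d + d * pi * (2 * h - 1))
      = 2 * pi * (R / pi * x + c / (pi * R) * y + D * m / (pi * w * R) * z - d * h)" for x y z D m w h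
      by (simp add: algebra_simps)
    then show ?thesis unfolding Y rim_eq c_def .
  qed
qed

subsection \<open>Change to cylindrical coordinates\<close>

lemma continuous_on_vector_3:
  fixes f1 f2 f3 :: "'a::t2_space \<Rightarrow> real"
  assumes "continuous_on S f1" "continuous_on S f2" "continuous_on S f3"
  shows "continuous_on S (\<lambda>p. vector [f1 p, f2 p, f3 p] :: real^3)"
proof -
  have eq: "(\<lambda>p. vector [f1 p, f2 p, f3 p] :: real^3) = (\<lambda>p. \<chi> i. if i = 1 then f1 p else if i = 2 then f2 p else f3 p)"
    by (simp add: fun_eq_iff vec_eq_iff forall_3)
  show ?thesis unfolding eq
  proof (rule continuous_on_vec_lambda)
    show "continuous_on S (\<lambda>p. if i = 1 then f1 p else if i = 2 then f2 p else f3 p)" for i :: 3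
      using assms by (cases "i = 1"; cases "i = 2") auto
  qed
qed

lemma prod_Basis_cart:
  fixes F :: "real^'n \<Rightarrow> 'b::comm_monoid_mult"
  shows "(\<Prod>b\<in>Basis. F b) = (\<Prod>i\<in>UNIV. F (axis i 1))"
proof -
  have "(Basis :: (real^'n) set) = (\<lambda>i. axis i 1) ` UNIV"
    by (auto simp: Basis_vec_def)
  moreover have "inj (\<lambda>i::'n. axis i (1::real))"
    by (auto simp: inj_on_def axis_eq_axis)
  ultimately show ?thesis using prod.reindex[of "\<lambda>i. axis i 1" UNIV F] by (simp only: o_def)
qed

text \<open>The height is listed first so that it becomes the outermost variable of the iterated
  integral. Lebesgue measure is determined by its values on boxes, and the preimage of a box is a
  product of intervals.\<close>

lemma lborel_vector_3:
  "(lborel :: (real^3) measure) = distr lborel borel (\<lambda>(z, x, y). vector [x, y, z])"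
proof (rule lborel_eqI)
  let ?p = "\<lambda>(z, x, y). vector [x, y, z] :: real^3"
  have p [measurable]: "?p \<in> borel \<rightarrow>\<^sub>M borel"
    unfolding case_prod_unfold
    by (intro borel_measurable_continuous_onI continuous_on_vector_3 continuous_intros)
  fix l u :: "real^3" assume "\<And>b. b \<in> Basis \<Longrightarrow> l \<bullet> b \<le> u \<bullet> b"
  from this[of "axis i 1" for i] have le: "l $ i \<le> u $ i" for i
    by (simp add: inner_axis)
  have vimage: "?p -` box l u = {l$3<..<u$3} \<times> ({l$1<..<u$1} \<times> {l$2<..<u$2})"
    by (auto simp: mem_box_cart forall_3)
  have "emeasure (distr lborel borel ?p) (box l u) = emeasure lborel ({l$3<..<u$3} \<times> ({l$1<..<u$1} \<times> {l$2<..<u$2}))"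
    by (subst emeasure_distr) (auto simp: vimage)
  also have "\<dots> = emeasure lborel {l$3<..<u$3} * (emeasure lborel {l$1<..<u$1} * emeasure lborel {l$2<..<u$2})"
    using lborel.emeasure_pair_measure_Times[of "{l$3<..<u$3}" lborel "{l$1<..<u$1} \<times> {l$2<..<u$2}", unfolded lborel_prod]
      lborel.emeasure_pair_measure_Times[of "{l$1<..<u$1}" lborel "{l$2<..<u$2}", unfolded lborel_prod]
    by (simp add: borel_Times)
  also have "\<dots> = ennreal ((u$3 - l$3) * ((u$1 - l$1) * (u$2 - l$2)))"
    using le by (simp add: ennreal_mult)
  also have "(u$3 - l$3) * ((u$1 - l$1) * (u$2 - l$2)) = (\<Prod>b\<in>Basis. (u - l) \<bullet> b)"
    unfolding prod_Basis_cart UNIV_3 by (simp add: inner_axis)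
  finally show "emeasure (distr lborel borel ?p) (box l u) = ennreal (\<Prod>b\<in>Basis. (u - l) \<bullet> b)" .
qed simp

lemma nn_integral_vector_3:
  fixes F :: "real^3 \<Rightarrow> ennreal"
  assumes [measurable]: "F \<in> borel_measurable borel"
  shows "(\<integral>\<^sup>+x. F x \<partial>lborel) = (\<integral>\<^sup>+z. \<integral>\<^sup>+x. \<integral>\<^sup>+y. F (vector [x, y, z]) \<partial>lborel \<partial>lborel \<partial>lborel)"
proof -
  have p [measurable]: "(\<lambda>(z, x, y). vector [x, y, z] :: real^3) \<in> borel \<rightarrow>\<^sub>M borel"
    unfolding case_prod_unfold
    by (intro borel_measurable_continuous_onI continuous_on_vector_3 continuous_intros)
  have m: "(\<lambda>w. F (case w of (z, x, y) \<Rightarrow> vector [x, y, z])) \<in> borel_measurable borel"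
    by measurable
  then have m': "(\<lambda>w. F (case w of (z, x, y) \<Rightarrow> vector [x, y, z])) \<in> borel_measurable (lborel \<Otimes>\<^sub>M lborel)"
    unfolding lborel_prod by simp
  have "(\<lambda>w. F (case (z, w) of (z, x, y) \<Rightarrow> vector [x, y, z])) \<in> borel_measurable borel" for z
    using measurable_compose[OF _ m, of "\<lambda>w. (z, w)" borel] by (simp add: borel_prod[symmetric])
  then have m2: "(\<lambda>w. F (case w of (x, y) \<Rightarrow> vector [x, y, z])) \<in> borel_measurable (lborel \<Otimes>\<^sub>M lborel)" for z
    unfolding lborel_prod by (simp add: case_prod_unfold)
  have "(\<integral>\<^sup>+x. F x \<partial>lborel) = (\<integral>\<^sup>+w. F (case w of (z, x, y) \<Rightarrow> vector [x, y, z]) \<partial>lborel)"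
    by (subst lborel_vector_3) (simp add: nn_integral_distr)
  also have "\<dots> = (\<integral>\<^sup>+z. \<integral>\<^sup>+w. F (case w of (x, y) \<Rightarrow> vector [x, y, z]) \<partial>lborel \<partial>lborel)"
    using lborel.nn_integral_fst[OF m'] by (simp add: lborel_prod)
  also have "\<dots> = (\<integral>\<^sup>+z. \<integral>\<^sup>+x. \<integral>\<^sup>+y. F (vector [x, y, z]) \<partial>lborel \<partial>lborel \<partial>lborel)"
    using lborel.nn_integral_fst[OF m2] by (simp add: lborel_prod)
  finally show ?thesis .
qed

text \<open>A dictionary between "absolutely integrable with integral \<open>b\<close>", the form in
  which the change of variables is available, and nonnegative integrals with finite value
  \<open>b\<close>.\<close>

lemma has_absolute_integral_iff_nn_integral:
  fixes F :: "'a::euclidean_space \<Rightarrow> real"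
  assumes nonneg: "\<And>x. x \<in> T \<Longrightarrow> 0 \<le> F x"
    and meas: "(\<lambda>x. indicator T x * F x) \<in> borel_measurable lebesgue"
  shows "F absolutely_integrable_on T \<and> integral T F = b
    \<longleftrightarrow> 0 \<le> b \<and> (\<integral>\<^sup>+x. ennreal (indicator T x * F x) \<partial>lborel) = ennreal b"
proof
  assume L: "F absolutely_integrable_on T \<and> integral T F = b"
  then have b: "(F has_integral b) T"
    using set_lebesgue_integral_eq_integral(1)[of T F] by (auto simp: has_integral_iff)
  have "(\<integral>\<^sup>+x. ennreal (indicator T x * F x) \<partial>lborel) = ennreal b"
    by (rule nn_integral_has_integral_lebesgue[OF nonneg b])
  moreover have "0 \<le> b" using b nonneg by (rule has_integral_nonneg)
  ultimately show "0 \<le> b \<and> (\<integral>\<^sup>+x. ennreal (indicator T x * F x) \<partial>lborel) = ennreal b"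
    by simp
next
  assume R: "0 \<le> b \<and> (\<integral>\<^sup>+x. ennreal (indicator T x * F x) \<partial>lborel) = ennreal b"
  have nn: "0 \<le> indicator T x * F x" for x using nonneg by (auto simp: indicator_def)
  have "integrable lebesgue (\<lambda>x. indicator T x * F x)"
    using R by (intro integrableI_nonneg meas) (auto simp: nn nn_integral_completion)
  then have ai: "F absolutely_integrable_on T"
    by (simp add: set_integrable_def)
  moreover have "(LINT x:T|lebesgue. F x) = b"
    unfolding set_lebesgue_integral_def real_scaleR_def
    using R by (subst integral_eq_nn_integral) (auto simp: nn meas nn_integral_completion)
  ultimately show "F absolutely_integrable_on T \<and> integral T F = b"
    using set_lebesgue_integral_eq_integral(2)[OF ai] by simp
qed

text \<open>By the dictionary, each finite value is attained by one side exactly when it is attained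
  by the other. Hence an infinite value on one side forces an infinite value on the other.\<close>

lemma nn_integral_change_of_variables:
  fixes g :: "real^'m::{finite,wellorder} \<Rightarrow> real^'m::_" and F :: "real^'m::_ \<Rightarrow> real"
  assumes S: "S \<in> sets lebesgue"
    and der: "\<And>x. x \<in> S \<Longrightarrow> (g has_derivative g' x) (at x within S)"
    and inj: "inj_on g S"
    and nonneg: "\<And>y. y \<in> g ` S \<Longrightarrow> 0 \<le> F y"
    and meas: "(\<lambda>y. indicator (g ` S) y * F y) \<in> borel_measurable lebesgue"
    and meas': "(\<lambda>x. indicator S x * (\<bar>det (matrix (g' x))\<bar> * F (g x))) \<in> borel_measurable lebesgue"
  shows "(\<integral>\<^sup>+y. ennreal (indicator (g ` S) y * F y) \<partial>lborel)
       = (\<integral>\<^sup>+x. ennreal (indicator S x * (\<bar>det (matrix (g' x))\<bar> * F (g x))) \<partial>lborel)" (is "?A = ?B")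
proof -
  have *: "(\<lambda>x. \<bar>det (matrix (g' x))\<bar> * F (g x)) absolutely_integrable_on S \<and>
      integral S (\<lambda>x. \<bar>det (matrix (g' x))\<bar> * F (g x)) = b
    \<longleftrightarrow> F absolutely_integrable_on (g ` S) \<and> integral (g ` S) F = b" for b
    \<comment> \<open>The theorem is about vector-valued integrands, so \<open>F\<close> is passed
      through \<open>real^1\<close>.\<close>
    using has_absolute_integral_change_of_variables[OF S der inj, of "\<lambda>x. vec (F x) :: real^1" "vec b"]
    by (simp add: absolutely_integrable_on_1_iff integral_on_1_eq vec_eq_iff)
  have eq: "0 \<le> b \<and> ?A = ennreal b \<longleftrightarrow> 0 \<le> b \<and> ?B = ennreal b" for b
    using *[of b] has_absolute_integral_iff_nn_integral[OF nonneg meas, of b]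
      has_absolute_integral_iff_nn_integral[OF _ meas', of b] nonneg by auto
  show ?thesis
  proof (cases ?A rule: ennreal_cases)
    case (real r)
    then show ?thesis using eq[of r] by simp
  next
    case A: top
    show ?thesis
    proof (cases ?B rule: ennreal_cases)
      case (real r)
      then have "?A = ennreal r" using eq[of r] by simp
      then show ?thesis using real by simp
    qed (use A in simp)
  qed
qed

section \<open>The cylindrical coordinate map\<close>

lemma polar_norm_square: "(c * cos t)\<^sup>2 + (c * sin t)\<^sup>2 = (c::real)\<^sup>2"
  by (simp add: power_mult_distrib flip: distrib_left)

lemma continuous_on_cyl:
  fixes s t z :: "'a::t2_space \<Rightarrow> real"
  assumes "continuous_on S s" "continuous_on S t" "continuous_on S z"
  shows "continuous_on S (\<lambda>x. cyl (s x) (t x) (z x))"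
  unfolding cyl_def by (intro continuous_on_vector_3 continuous_intros assms)

text \<open>The offset \<open>\<phi>\<close> will be the azimuth of the field point, so that
  distances depend on the angular variable only through its cosine.\<close>

lemma has_derivative_cyl:
  fixes x :: "real^3"
  shows "((\<lambda>x. cyl (x$1) (x$2 + \<phi>) (x$3)) has_derivative
    (\<lambda>h. vector [h$1 * cos (x$2 + \<phi>) - x$1 * sin (x$2 + \<phi>) * h$2,
                  h$1 * sin (x$2 + \<phi>) + x$1 * cos (x$2 + \<phi>) * h$2, h$3])) (at x within S)"
proof -
  have nth: "((\<lambda>x. x $ i) has_derivative (\<lambda>h. h $ i)) (at x within S)" for i :: 3
    by (rule bounded_linear_imp_has_derivative[OF bounded_linear_vec_nth])
  have "((\<lambda>x. cyl (x$1) (x$2 + \<phi>) (x$3) $ i) has_derivative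
    (\<lambda>h. vector [h$1 * cos (x$2 + \<phi>) - x$1 * sin (x$2 + \<phi>) * h$2,
                  h$1 * sin (x$2 + \<phi>) + x$1 * cos (x$2 + \<phi>) * h$2, h$3] $ i)) (at x within S)" for i :: 3
  proof -
    consider "i = 1" | "i = 2" | "i = 3" using exhaust_3 by blast
    then show ?thesis
      by cases (auto simp: cyl_def intro!: derivative_eq_intros nth)
  qed
  then show ?thesis
    by (subst has_derivative_componentwise_within) (auto simp: Basis_vec_def inner_axis)
qed

lemma det_cyl:
  "det (matrix (\<lambda>h :: real^3. vector [h$1 * cos t - c * sin t * h$2,
                  h$1 * sin t + c * cos t * h$2, h$3] :: real^3)) = c"
proof -
  have "c * (cos t * cos t) + c * (sin t * sin t) = c"
    by (simp flip: distrib_left power2_eq_square)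
  then show ?thesis
    by (simp add: det_3 matrix_def axis_def algebra_simps)
qed

text \<open>The left-hand vector is \<open>y\<close> turned by \<open>- \<phi>\<close> about the
  axis; its azimuth \<open>t\<close> is thus the azimuth of \<open>y\<close> relative to
  \<open>\<phi>\<close>.\<close>

lemma cyl_rotate:
  assumes "vector [y$1 * cos \<phi> + y$2 * sin \<phi>, y$2 * cos \<phi> - y$1 * sin \<phi>, y$3] = cyl s t z"
  shows "y = cyl s (t + \<phi>) z"
proof -
  have e: "y$1 * cos \<phi> + y$2 * sin \<phi> = s * cos t" "y$2 * cos \<phi> - y$1 * sin \<phi> = s * sin t" "y$3 = z"
    using assms by (simp_all add: cyl_def vec_eq_iff forall_3)
  have sc: "cos \<phi> * cos \<phi> + sin \<phi> * sin \<phi> = 1"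
    by (simp flip: power2_eq_square)
  have 1: "s * cos (t + \<phi>) = y$1"
    using e(1,2) sc unfolding cos_add by algebra
  have 2: "s * sin (t + \<phi>) = y$2"
    using e(1,2) sc unfolding sin_add by algebra
  show ?thesis using e 1 2 by (simp add: cyl_def vec_eq_iff forall_3)
qed

lemma inj_on_cyl:
  "inj_on (\<lambda>x::real^3. cyl (x$1) (x$2 + \<phi>) (x$3)) {x. 0 < x$1 \<and> 0 < x$2 \<and> x$2 < 2*pi}"
proof (rule inj_onI, clarify)
  fix x y :: "real^3"
  assume x: "0 < x$1" "0 < x$2" "x$2 < 2*pi" and y: "0 < y$1" "0 < y$2" "y$2 < 2*pi"
    and "cyl (x$1) (x$2 + \<phi>) (x$3) = cyl (y$1) (y$2 + \<phi>) (y$3)"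
  then have e: "x$1 * cos (x$2 + \<phi>) = y$1 * cos (y$2 + \<phi>)"
      "x$1 * sin (x$2 + \<phi>) = y$1 * sin (y$2 + \<phi>)" "x$3 = y$3"
    by (simp_all add: cyl_def vec_eq_iff forall_3)
  have "(x$1)\<^sup>2 = (y$1)\<^sup>2"
    using polar_norm_square[of "x$1" "x$2 + \<phi>"] polar_norm_square[of "y$1" "y$2 + \<phi>"] e by simp
  then have 1: "x$1 = y$1" using x y by (simp add: power2_eq_iff)
  then have "sin (x$2 + \<phi>) = sin (y$2 + \<phi>) \<and> cos (x$2 + \<phi>) = cos (y$2 + \<phi>)"
    using e x by simp
  then obtain n where n: "x$2 + \<phi> = y$2 + \<phi> + 2 * pi * of_int n"
    unfolding sin_cos_eq_iff by blast
  \<comment> \<open>Both angles lie in an open interval of length \<open>2 * pi\<close>, which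
    leaves no room for a full turn.\<close>
  have "\<bar>2 * pi * of_int n\<bar> < 2 * pi * 1" using n x y by linarith
  then have "n = 0" by (simp add: abs_mult)
  with n 1 e show "x = y" by (simp add: vec_eq_iff forall_3)
qed

text \<open>A missed point has radius 0 or relative azimuth 0, so it lies in the vertical plane
  through the axis at azimuth \<open>\<phi>\<close>. The vector \<open>?n\<close> is normal to that
  plane.\<close>

lemma negligible_compl_range_cyl:
  "negligible (- (\<lambda>x::real^3. cyl (x$1) (x$2 + \<phi>) (x$3)) ` {x. 0 < x$1 \<and> 0 < x$2 \<and> x$2 < 2*pi})"
proof (rule negligible_subset)
  let ?n = "vector [- sin \<phi>, cos \<phi>, 0] :: real^3"
  have inner: "?n \<bullet> y = y$2 * cos \<phi> - y$1 * sin \<phi>" for y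
    by (simp add: inner_vec_def sum_3)
  have "?n \<noteq> 0"
    by (auto simp: vec_eq_iff forall_3 dest: sin_zero_abs_cos_one)
  then show "negligible {y. ?n \<bullet> y = 0}"
    by (rule negligible_hyperplane[OF disjI1])
  show "- (\<lambda>x::real^3. cyl (x$1) (x$2 + \<phi>) (x$3)) ` {x. 0 < x$1 \<and> 0 < x$2 \<and> x$2 < 2*pi} \<subseteq> {y. ?n \<bullet> y = 0}"
  proof clarify
    fix y :: "real^3"
    assume notin: "y \<notin> (\<lambda>x::real^3. cyl (x$1) (x$2 + \<phi>) (x$3)) ` {x. 0 < x$1 \<and> 0 < x$2 \<and> x$2 < 2*pi}"
    obtain s t z where st: "0 \<le> s" "0 \<le> t" "t < 2 * pi"
      and eq: "vector [y$1 * cos \<phi> + y$2 * sin \<phi>, y$2 * cos \<phi> - y$1 * sin \<phi>, y$3] = cyl s t z"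
      using cyl_exists by blast
    show "?n \<bullet> y = 0"
    proof (rule ccontr)
      assume "?n \<bullet> y \<noteq> 0"
      moreover have "y$2 * cos \<phi> - y$1 * sin \<phi> = s * sin t"
        using eq by (simp add: cyl_def vec_eq_iff forall_3)
      ultimately have "s * sin t \<noteq> 0" unfolding inner by simp
      then have "0 < s" "0 < t" using st by (auto simp: less_le)
      then have "y \<in> (\<lambda>x::real^3. cyl (x$1) (x$2 + \<phi>) (x$3)) ` {x. 0 < x$1 \<and> 0 < x$2 \<and> x$2 < 2*pi}"
        using st cyl_rotate[OF eq] by (intro image_eqI[of _ _ "vector [s, t, z]"]) auto
      with notin show False by contradiction
    qed
  qed
qed

lemma nn_integral_cylindrical:
  fixes F :: "real^3 \<Rightarrow> real"
  assumes meas [measurable]: "F \<in> borel_measurable borel" and nonneg: "\<And>y. 0 \<le> F y"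
  shows "(\<integral>\<^sup>+y. ennreal (F y) \<partial>lborel) =
    (\<integral>\<^sup>+z. \<integral>\<^sup>+s. \<integral>\<^sup>+t. ennreal (indicator {0<..} s * indicator {0<..<2*pi} t * (s * F (cyl s (t + \<phi>) z)))
       \<partial>lborel \<partial>lborel \<partial>lborel)"
proof -
  define g where "g = (\<lambda>x::real^3. cyl (x$1) (x$2 + \<phi>) (x$3))"
  define S where "S = {x::real^3. 0 < x$1 \<and> 0 < x$2 \<and> x$2 < 2*pi}"
  define g' where "g' = (\<lambda>(x :: real^3) h :: real^3. vector [h$1 * cos (x$2 + \<phi>) - x$1 * sin (x$2 + \<phi>) * h$2,
                  h$1 * sin (x$2 + \<phi>) + x$1 * cos (x$2 + \<phi>) * h$2, h$3] :: real^3)"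
  have det: "det (matrix (g' x)) = x$1" for x
    unfolding g'_def by (rule det_cyl)
  have nth [measurable]: "(\<lambda>x::real^3. x $ i) \<in> borel_measurable borel" for i
    by (intro borel_measurable_continuous_onI continuous_intros)
  have g [measurable]: "g \<in> borel \<rightarrow>\<^sub>M borel"
    unfolding g_def by (intro borel_measurable_continuous_onI continuous_on_cyl continuous_intros)
  have S [measurable]: "S \<in> sets borel"
    unfolding S_def by measurable
  have neg: "negligible (- g ` S)"
    unfolding g_def S_def by (rule negligible_compl_range_cyl)
  \<comment> \<open>Lebesgue measurability of the image comes from its complement being
    negligible.\<close>
  then have gS [measurable]: "g ` S \<in> sets lebesgue"
    by (metis Compl_in_sets_lebesgue negligible_imp_sets)
  have AE: "AE y in lborel. y \<in> g ` S"
    using AE_not_in[of "- g ` S" lebesgue] neg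
    unfolding negligible_iff_null_sets AE_completion_iff by simp
  have "(\<integral>\<^sup>+y. ennreal (F y) \<partial>lborel) = (\<integral>\<^sup>+y. ennreal (indicator (g ` S) y * F y) \<partial>lborel)"
    using AE by (intro nn_integral_cong_AE) auto
  also have "\<dots> = (\<integral>\<^sup>+x. ennreal (indicator S x * (\<bar>det (matrix (g' x))\<bar> * F (g x))) \<partial>lborel)"
  proof (rule nn_integral_change_of_variables)
    show "(g has_derivative g' x) (at x within S)" for x
      unfolding g_def g'_def by (rule has_derivative_cyl)
    show "inj_on g S"
      unfolding g_def S_def by (rule inj_on_cyl)
    have "F \<in> borel_measurable lebesgue" by (intro measurable_completion) simp
    then show "(\<lambda>y. indicator (g ` S) y * F y) \<in> borel_measurable lebesgue"
      by measurable
    show "(\<lambda>x. indicator S x * (\<bar>det (matrix (g' x))\<bar> * F (g x))) \<in> borel_measurable lebesgue"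
      unfolding det by (intro measurable_completion) measurable
  qed (use nonneg in auto)
  also have "\<dots> = (\<integral>\<^sup>+x. ennreal (indicator S x * (x$1 * F (g x))) \<partial>lborel)"
    unfolding det by (intro nn_integral_cong) (auto simp: indicator_def S_def)
  also have "\<dots> = (\<integral>\<^sup>+z. \<integral>\<^sup>+s. \<integral>\<^sup>+t. ennreal (indicator S (vector [s, t, z]) * (s * F (cyl s (t + \<phi>) z)))
       \<partial>lborel \<partial>lborel \<partial>lborel)"
    by (subst nn_integral_vector_3, measurable) (simp add: g_def)
  also have "\<dots> = (\<integral>\<^sup>+z. \<integral>\<^sup>+s. \<integral>\<^sup>+t. ennreal (indicator {0<..} s * indicator {0<..<2*pi} t * (s * F (cyl s (t + \<phi>) z)))
       \<partial>lborel \<partial>lborel \<partial>lborel)"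
    by (intro nn_integral_cong) (auto simp: S_def indicator_def)
  finally show ?thesis .
qed

text \<open>The points whose height lies in a null set \<open>N\<close> form a null set, by Tonelli
  with the height outermost. This lets \<open>f\<close> be altered on a null set of heights without
  changing the solid, up to a null set.\<close>

lemma AE_vec_nth_3:
  assumes "AE z in lborel. P z"
  shows "AE x in (lborel :: (real^3) measure). P (x $ 3)"
proof -
  from assms obtain N where N: "N \<in> null_sets lborel" "{z. \<not> P z} \<subseteq> N"
    by (auto elim!: AE_E simp: null_sets_def)
  then have [measurable]: "N \<in> sets borel" by auto
  have nth [measurable]: "(\<lambda>x::real^3. x $ i) \<in> borel_measurable borel" for i
    by (intro borel_measurable_continuous_onI continuous_intros)
  have "emeasure lborel {x::real^3. x $ 3 \<in> N} = (\<integral>\<^sup>+x. indicator N ((x::real^3) $ 3) \<partial>lborel)"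
  proof -
    have "(\<lambda>x::real^3. indicator N (x $ 3) :: ennreal) = indicator {x. x $ 3 \<in> N}"
      by (auto simp: indicator_def)
    then show ?thesis by simp
  qed
  also have "\<dots> = (\<integral>\<^sup>+z. \<integral>\<^sup>+x. \<integral>\<^sup>+y. indicator N z \<partial>(lborel :: real measure) \<partial>(lborel :: real measure) \<partial>lborel)"
    by (subst nn_integral_vector_3) simp_all
  also have "\<dots> = (\<integral>\<^sup>+z. 0 \<partial>(lborel :: real measure))"
    using AE_not_in[OF N(1)] by (intro nn_integral_cong_AE) auto
  finally have "{x::real^3. x $ 3 \<in> N} \<in> null_sets lborel"
    by (auto simp: null_sets_def)
  then show ?thesis
    by (rule AE_I') (use N in auto)
qed

subsection \<open>Slicing the solid of revolution\<close>

text \<open>The numerator \<open>s\<close> is the Jacobian of polar coordinates. The domain is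
  folded into the kernel, which makes it a nonnegative function on all of the plane that is Borel
  also in \<open>a\<close> and \<open>d\<close>.\<close>

definition disk_kernel :: "real \<Rightarrow> real \<Rightarrow> real \<Rightarrow> real \<Rightarrow> real \<Rightarrow> real" where
  "disk_kernel a b d s t =
     (if 0 < s \<and> s \<le> a \<and> 0 < t \<and> t < 2*pi then s / sqrt (d\<^sup>2 + (s\<^sup>2 + b\<^sup>2 - 2 * s * b * cos t)) else 0)"

text \<open>Nonnegativity is not visible in the closed formula, which subtracts a step term; it
  holds because the rim integral is an integral of the nonnegative kernel. Positive \<open>d\<close>
  keeps that kernel continuous and all values finite.\<close>

lemma
  assumes a: "0 \<le> a" and b: "0 \<le> b" and d: "0 < d"
  shows Y_fun_nonneg: "0 \<le> a * Y_fun a b d"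
    and nn_integral_disk: "(\<integral>\<^sup>+s. \<integral>\<^sup>+t. ennreal (disk_kernel a b d s t) \<partial>lborel \<partial>lborel)
       = ennreal (2 * pi * (a * Y_fun a b d))"
proof -
  define k where "k s t = s / sqrt (d\<^sup>2 + (s\<^sup>2 + b\<^sup>2 - 2 * s * b * cos t))" for s t
  have pos: "d\<^sup>2 + (s\<^sup>2 + b\<^sup>2 - 2 * s * b * cos t) > 0" for s t
    using law_of_cosines_nonneg[of s b t] d by (simp add: add_pos_nonneg)
  have knn: "0 \<le> k s t" if "0 \<le> s" for s t
    using that pos[of s t] by (simp add: k_def less_imp_le)
  have ik: "(k s has_integral integral {0..2*pi} (k s)) {0..2*pi}" for s
    unfolding k_def using pos[of s]
    by (intro integrable_integral integrable_continuous_real continuous_intros) (simp add: less_le)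
  have iknn: "0 \<le> integral {0..2*pi} (k s)" if "0 \<le> s" for s
    using ik by (rule has_integral_nonneg) (rule knn[OF that])
  have outer: "((\<lambda>s. integral {0..2*pi} (k s)) has_integral rim_integral a b d) {0..a}"
    unfolding k_def by (rule disk_integral_eq_rim_integral[OF a d])
  have rim_nn: "0 \<le> rim_integral a b d"
    using outer by (rule has_integral_nonneg) (simp add: iknn)
  have rim: "rim_integral a b d = 2 * pi * (a * Y_fun a b d)"
  proof (cases "a = 0")
    case True
    then show ?thesis by (simp add: rim_integral_def)
  next
    case False
    then show ?thesis using a by (intro rim_integral_eq_Y_fun b d) simp
  qed
  show "0 \<le> a * Y_fun a b d"
    using rim_nn[unfolded rim] by (intro mult_left_le_imp_le[of "2 * pi" 0]) simp_all
  have inner: "(\<integral>\<^sup>+t. ennreal (disk_kernel a b d s t) \<partial>lborel)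
      = ennreal (indicator {0..a} s * integral {0..2*pi} (k s))" for s
  proof (cases "0 < s \<and> s \<le> a")
    case True
    have "(\<integral>\<^sup>+t. ennreal (disk_kernel a b d s t) \<partial>lborel) = (\<integral>\<^sup>+t. ennreal (indicator {0<..<2*pi} t * k s t) \<partial>lborel)"
      using True by (intro nn_integral_cong) (auto simp: disk_kernel_def k_def indicator_def)
    also have "\<dots> = ennreal (integral {0..2*pi} (k s))"
      using ik True by (intro nn_integral_has_integral_lebesgue knn) (auto simp: has_integral_Icc_iff_Ioo)
    finally show ?thesis using True by simp
  next
    case False
    \<comment> \<open>The closed interval contains \<open>s = 0\<close> while
      \<open>disk_kernel\<close> excludes it; the Jacobian makes both sides 0 there.\<close>
    have k0: "k 0 = (\<lambda>_. 0)" by (simp add: k_def fun_eq_iff)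
    from False have ind0: "indicator {0..a} s * integral {0..2*pi} (k s) = 0"
      by (auto simp: indicator_def k0)
    have "disk_kernel a b d s t = 0" for t
      using False by (auto simp: disk_kernel_def)
    then show ?thesis unfolding ind0 by simp
  qed
  show "(\<integral>\<^sup>+s. \<integral>\<^sup>+t. ennreal (disk_kernel a b d s t) \<partial>lborel \<partial>lborel)
       = ennreal (2 * pi * (a * Y_fun a b d))"
    unfolding inner rim[symmetric] by (intro nn_integral_has_integral_lebesgue outer) (simp add: iknn)
qed

section \<open>The solid as a stack of disks\<close>

lemma norm_cyl_diff:
  "norm (cyl b \<phi> z - cyl s (t + \<phi>) z') = sqrt (\<bar>z - z'\<bar>\<^sup>2 + (s\<^sup>2 + b\<^sup>2 - 2 * s * b * cos t))"
proof -
  have t: "cos t = cos (t + \<phi>) * cos \<phi> + sin (t + \<phi>) * sin \<phi>"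
    using cos_diff[of "t + \<phi>" \<phi>] by simp
  have "(b * cos \<phi> - s * cos (t + \<phi>))\<^sup>2 + (b * sin \<phi> - s * sin (t + \<phi>))\<^sup>2
    = ((b * cos \<phi>)\<^sup>2 + (b * sin \<phi>)\<^sup>2) + ((s * cos (t + \<phi>))\<^sup>2 + (s * sin (t + \<phi>))\<^sup>2) - 2 * s * b * cos t"
    unfolding t by (simp add: power2_diff algebra_simps)
  then have "(b * cos \<phi> - s * cos (t + \<phi>))\<^sup>2 + (b * sin \<phi> - s * sin (t + \<phi>))\<^sup>2 = s\<^sup>2 + b\<^sup>2 - 2 * s * b * cos t"
    unfolding polar_norm_square by simp
  then show ?thesis
    by (simp add: norm_vec_def L2_set_def sum_3 cyl_def add.commute)
qed

text \<open>In Cartesian form no existential over angles remains: the set is visibly Borel for a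
  Borel profile, and the profile enters only through its value at the height of
  \<open>y\<close>.\<close>

lemma mem_solid_of_revolution_iff:
  assumes "\<And>z'. z' \<in> {- z0..z1} \<Longrightarrow> 0 \<le> f z'"
  shows "y \<in> solid_of_revolution z0 z1 f \<longleftrightarrow> y$3 \<in> {- z0..z1} \<and> (y$1)\<^sup>2 + (y$2)\<^sup>2 \<le> (f (y$3))\<^sup>2"
proof -
  obtain s t z where st: "0 \<le> s" "0 \<le> t" "t < 2 * pi" and y: "y = cyl s t z"
    using cyl_exists by blast
  have coords: "y$3 = z" "(y$1)\<^sup>2 + (y$2)\<^sup>2 = s\<^sup>2"
    by (simp_all add: y cyl_def polar_norm_square)
  show ?thesis
  proof
    assume "y \<in> solid_of_revolution z0 z1 f"
    then obtain s' t' z' where y': "y = cyl s' t' z'" "- z0 \<le> z'" "z' \<le> z1" "0 \<le> s'" "s' \<le> f z'"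
      unfolding solid_of_revolution_def by blast
    then have "y$3 = z'" "(y$1)\<^sup>2 + (y$2)\<^sup>2 = s'\<^sup>2"
      by (simp_all add: cyl_def polar_norm_square)
    then show "y$3 \<in> {- z0..z1} \<and> (y$1)\<^sup>2 + (y$2)\<^sup>2 \<le> (f (y$3))\<^sup>2"
      using y' by (simp add: power_mono)
  next
    assume R: "y$3 \<in> {- z0..z1} \<and> (y$1)\<^sup>2 + (y$2)\<^sup>2 \<le> (f (y$3))\<^sup>2"
    then have "s\<^sup>2 \<le> (f z)\<^sup>2" and z: "z \<in> {- z0..z1}" by (simp_all only: coords)
    then have "s \<le> f z" using assms[OF z] by (blast intro: power2_le_imp_le)
    then show "y \<in> solid_of_revolution z0 z1 f"
      using z st unfolding y solid_of_revolution_def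
      by (intro CollectI exI[of _ s] exI[of _ t] exI[of _ z]) auto
  qed
qed

lemma nn_integral_solid:
  fixes g :: "real \<Rightarrow> real"
  assumes g [measurable]: "g \<in> borel_measurable borel" and I [measurable]: "I \<in> sets borel"
    and gnn: "\<And>z. 0 \<le> g z" and b: "0 \<le> b"
  shows "(\<integral>\<^sup>+y. ennreal (indicator {y. y$3 \<in> I \<and> (y$1)\<^sup>2 + (y$2)\<^sup>2 \<le> (g (y$3))\<^sup>2} y / norm (cyl b \<phi> z - y)) \<partial>lborel)
    = (\<integral>\<^sup>+z'. indicator I z' * (\<integral>\<^sup>+s. \<integral>\<^sup>+t. ennreal (disk_kernel (g z') b \<bar>z - z'\<bar> s t) \<partial>lborel \<partial>lborel) \<partial>lborel)"
proof -
  have nth [measurable]: "(\<lambda>x::real^3. x $ i) \<in> borel_measurable borel" for i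
    by (intro borel_measurable_continuous_onI continuous_intros)
  define B where "B = {y::real^3. y$3 \<in> I \<and> (y$1)\<^sup>2 + (y$2)\<^sup>2 \<le> (g (y$3))\<^sup>2}"
  have B [measurable]: "B \<in> sets borel"
    unfolding B_def by measurable
  have mem: "cyl s t z' \<in> B \<longleftrightarrow> z' \<in> I \<and> s \<le> g z'" if "0 < s" for s t z'
    using that gnn[of z'] by (simp add: B_def cyl_def polar_norm_square power2_le_iff_abs_le)
  have "(\<integral>\<^sup>+y. ennreal (indicator B y / norm (cyl b \<phi> z - y)) \<partial>lborel)
    = (\<integral>\<^sup>+z'. \<integral>\<^sup>+s. \<integral>\<^sup>+t. ennreal (indicator {0<..} s * indicator {0<..<2*pi} t *
        (s * (indicator B (cyl s (t + \<phi>) z') / norm (cyl b \<phi> z - cyl s (t + \<phi>) z')))) \<partial>lborel \<partial>lborel \<partial>lborel)"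
    by (rule nn_integral_cylindrical) auto
  also have "\<dots> = (\<integral>\<^sup>+z'. indicator I z' * (\<integral>\<^sup>+s. \<integral>\<^sup>+t. ennreal (disk_kernel (g z') b \<bar>z - z'\<bar> s t) \<partial>lborel \<partial>lborel) \<partial>lborel)"
  proof (rule nn_integral_cong)
    fix z'
    have eq: "indicator {0<..} s * indicator {0<..<2*pi} t *
        (s * (indicator B (cyl s (t + \<phi>) z') / norm (cyl b \<phi> z - cyl s (t + \<phi>) z')))
      = indicator I z' * disk_kernel (g z') b \<bar>z - z'\<bar> s t" for s t
      using mem[of s "t + \<phi>" z'] unfolding norm_cyl_diff
      by (auto simp: disk_kernel_def indicator_def)
    show "(\<integral>\<^sup>+s. \<integral>\<^sup>+t. ennreal (indicator {0<..} s * indicator {0<..<2*pi} t *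
        (s * (indicator B (cyl s (t + \<phi>) z') / norm (cyl b \<phi> z - cyl s (t + \<phi>) z')))) \<partial>lborel \<partial>lborel)
      = indicator I z' * (\<integral>\<^sup>+s. \<integral>\<^sup>+t. ennreal (disk_kernel (g z') b \<bar>z - z'\<bar> s t) \<partial>lborel \<partial>lborel)"
      unfolding eq by (cases "z' \<in> I") simp_all
  qed
  finally show ?thesis unfolding B_def .
qed

text \<open>The equality of integrals covers the divergent case too: the integral of a nonnegative
  measurable function is \<open>enn2real\<close> of its nonnegative integral, and
  \<open>enn2real\<close> sends infinity to 0.\<close>

lemma integrable_and_integral_of_nn_integral_eq:
  fixes u :: "'a \<Rightarrow> real" and v :: "'b \<Rightarrow> real"
  assumes u: "u \<in> borel_measurable M" "AE x in M. 0 \<le> u x"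
    and v: "v \<in> borel_measurable N" "AE x in N. 0 \<le> v x"
    and c: "0 < c"
    and eq: "(\<integral>\<^sup>+x. ennreal (u x) \<partial>M) = ennreal c * (\<integral>\<^sup>+x. ennreal (v x) \<partial>N)"
  shows "(integrable M u \<longleftrightarrow> integrable N v) \<and> integral\<^sup>L M u = c * integral\<^sup>L N v"
proof -
  have iff: "integrable K w \<longleftrightarrow> (\<integral>\<^sup>+x. ennreal (w x) \<partial>K) < \<infinity>"
    if "w \<in> borel_measurable K" "AE x in K. 0 \<le> w x" for K :: "'c measure" and w :: "'c \<Rightarrow> real"
    using that integrableI_nonneg[OF that] nn_integral_eq_integral[of K w] by auto
  have "(\<integral>\<^sup>+x. ennreal (u x) \<partial>M) < \<infinity> \<longleftrightarrow> (\<integral>\<^sup>+x. ennreal (v x) \<partial>N) < \<infinity>"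
    unfolding eq using c by (auto simp: ennreal_mult_less_top less_top[symmetric] ennreal_mult_eq_top_iff)
  then have "integrable M u \<longleftrightarrow> integrable N v"
    using iff[OF u] iff[OF v] by simp
  moreover have "integral\<^sup>L M u = c * integral\<^sup>L N v"
    using c by (simp add: integral_eq_nn_integral[OF u] integral_eq_nn_integral[OF v] eq enn2real_mult)
  ultimately show ?thesis by blast
qed

text \<open>An unbounded \<open>f\<close> may give an infinite potential, and a divergent integral
  is assigned the value 0. The equivalence of integrability ensures that the formula never equates a
  genuine value with such a 0.\<close>

theorem corollary2:
  fixes G \<rho> z0 z1 s \<phi> z :: real and f :: "real \<Rightarrow> real" and r :: "real ^ 3"
  assumes "G > 0" and "\<rho> > 0" and "- z0 < z1"
    and "f \<in> borel_measurable (lebesgue_on {- z0..z1})"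
    and "\<And>z'. z' \<in> {- z0..z1} \<Longrightarrow> 0 \<le> f z'"
    and "0 \<le> s" and "r = cyl s \<phi> z"
  shows "(set_integrable lebesgue (solid_of_revolution z0 z1 f) (\<lambda>r'. \<rho> / norm (r - r'))
            \<longleftrightarrow> set_integrable lebesgue {- z0..z1} (\<lambda>z'. f z' * Y_fun (f z') s \<bar>z - z'\<bar>))
    \<and> grav_potential G \<rho> (solid_of_revolution z0 z1 f) r
        = - 2 * pi * G * \<rho> * (LINT z':{- z0..z1}|lebesgue. f z' * Y_fun (f z') s \<bar>z - z'\<bar>)"
proof -
  define I where "I = {- z0..z1}"
  note fnn = assms(5)[folded I_def]
  have I [measurable]: "I \<in> sets borel" by (simp add: I_def)
  have "(\<lambda>x. if x \<in> I then f x else 0) \<in> borel_measurable lebesgue"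
    using assms(4) by (intro borel_measurable_if_I) (simp_all add: I_def)
  then obtain g0 where g0 [measurable]: "g0 \<in> borel_measurable borel"
    and g0_AE: "AE x in lborel. (if x \<in> I then f x else 0) = g0 x"
    using completion_ex_borel_measurable_real[of "\<lambda>x. if x \<in> I then f x else 0" lborel] by auto
  \<comment> \<open>Clipping at 0 preserves the almost everywhere equality with \<open>f\<close> on
    \<open>I\<close>, where \<open>f\<close> is nonnegative, and makes \<open>g\<close> nonnegative
    everywhere.\<close>
  define g where "g x = max 0 (g0 x)" for x
  have g [measurable]: "g \<in> borel_measurable borel" unfolding g_def by measurable
  have gnn: "0 \<le> g x" for x by (simp add: g_def)
  have fg: "AE x in lborel. x \<in> I \<longrightarrow> f x = g x"
    using g0_AE
  proof eventually_elim
    case (elim x)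
    then show ?case using fnn[of x] by (auto simp: g_def)
  qed
  \<comment> \<open>The slice formula needs \<open>d > 0\<close>, so the slice at the height of the
    field point is discarded.\<close>
  have zne: "AE z' in lborel. z' \<noteq> z"
    by (rule AE_lborel_singleton)
  define D where "D z' = (\<integral>\<^sup>+s'. \<integral>\<^sup>+t. ennreal (disk_kernel (g z') s \<bar>z - z'\<bar> s' t) \<partial>lborel \<partial>lborel)" for z'
  have D [measurable]: "D \<in> borel_measurable borel"
    unfolding D_def disk_kernel_def by measurable
  define h where "h z' = indicator I z' * (f z' * Y_fun (f z') s \<bar>z - z'\<bar>)" for z'
  have h_D: "AE z' in lborel. 0 \<le> h z' \<and> ennreal (2 * pi) * ennreal (h z') = indicator I z' * D z'"
    using fg zne
  proof eventually_elim
    case (elim z')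
    show ?case
    proof (cases "z' \<in> I")
      case True
      then have h: "h z' = g z' * Y_fun (g z') s \<bar>z - z'\<bar>" using elim by (simp add: h_def)
      have "0 < \<bar>z - z'\<bar>" using elim by simp
      note * = Y_fun_nonneg[OF gnn \<open>0 \<le> s\<close> this] nn_integral_disk[OF gnn \<open>0 \<le> s\<close> this]
      show ?thesis using True *[of z'] by (simp add: h D_def ennreal_mult)
    qed (simp add: h_def)
  qed
  \<comment> \<open>Dividing the Borel function \<open>D\<close> by \<open>2 * pi\<close> gives a
    measurable representative of \<open>h\<close>; this replaces any argument about measurability of
    the elliptic integrals in their parameters.\<close>
  have h_AE: "AE z' in lborel. enn2real (indicator I z' * D z') / (2 * pi) = h z'"
    using h_D
  proof eventually_elim
    case (elim z')
    then have D_h: "indicator I z' * D z' = ennreal (2 * pi * h z')"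
      by (simp add: ennreal_mult)
    show ?case using elim unfolding D_h by simp
  qed
  have h_meas: "h \<in> borel_measurable lebesgue"
  proof (rule borel_measurable_AE)
    show "(\<lambda>z'. enn2real (indicator I z' * D z') / (2 * pi)) \<in> borel_measurable lebesgue"
      by (intro measurable_completion) measurable
    show "AE z' in lebesgue. enn2real (indicator I z' * D z') / (2 * pi) = h z'"
      using h_AE by (simp add: AE_completion_iff)
  qed
  define Bg where "Bg = {y::real^3. y$3 \<in> I \<and> (y$1)\<^sup>2 + (y$2)\<^sup>2 \<le> (g (y$3))\<^sup>2}"
  have nth [measurable]: "(\<lambda>x::real^3. x $ i) \<in> borel_measurable borel" for i
    by (intro borel_measurable_continuous_onI continuous_intros)
  have Bg [measurable]: "Bg \<in> sets borel"
    unfolding Bg_def by measurable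
  define u where "u y = indicator (solid_of_revolution z0 z1 f) y * (\<rho> / norm (r - y))" for y
  \<comment> \<open>The solids of \<open>f\<close> and \<open>g\<close> differ only over heights
    where \<open>f\<close> and \<open>g\<close> differ.\<close>
  have u_AE: "AE y in lborel. \<rho> * (indicator Bg y / norm (r - y)) = u y"
    using AE_vec_nth_3[OF fg]
  proof eventually_elim
    case (elim y)
    then have "y \<in> solid_of_revolution z0 z1 f \<longleftrightarrow> y \<in> Bg"
      using mem_solid_of_revolution_iff[of z0 z1 f y, OF assms(5)] by (auto simp: Bg_def I_def)
    then show ?case by (simp add: u_def indicator_def)
  qed
  have u_meas: "u \<in> borel_measurable lebesgue"
  proof (rule borel_measurable_AE)
    show "(\<lambda>y. \<rho> * (indicator Bg y / norm (r - y))) \<in> borel_measurable lebesgue"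
      by (intro measurable_completion) measurable
    show "AE y in lebesgue. \<rho> * (indicator Bg y / norm (r - y)) = u y"
      using u_AE by (simp add: AE_completion_iff)
  qed
  have "(\<integral>\<^sup>+y. ennreal (u y) \<partial>lborel) = (\<integral>\<^sup>+y. ennreal \<rho> * ennreal (indicator Bg y / norm (r - y)) \<partial>lborel)"
  proof (rule nn_integral_cong_AE)
    show "AE y in lborel. ennreal (u y) = ennreal \<rho> * ennreal (indicator Bg y / norm (r - y))"
      using u_AE
    proof eventually_elim
      case (elim y)
      show ?case
        unfolding elim[symmetric] using \<open>\<rho> > 0\<close> by (simp add: ennreal_mult[symmetric])
    qed
  qed
  also have "\<dots> = ennreal \<rho> * (\<integral>\<^sup>+y. ennreal (indicator Bg y / norm (r - y)) \<partial>lborel)"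
    by (rule nn_integral_cmult) measurable
  also have "(\<integral>\<^sup>+y. ennreal (indicator Bg y / norm (r - y)) \<partial>lborel) = (\<integral>\<^sup>+z'. indicator I z' * D z' \<partial>lborel)"
    unfolding Bg_def D_def \<open>r = cyl s \<phi> z\<close> by (rule nn_integral_solid[OF g I gnn \<open>0 \<le> s\<close>])
  also have "\<dots> = (\<integral>\<^sup>+z'. ennreal (2 * pi) * ennreal (h z') \<partial>lebesgue)"
    unfolding nn_integral_completion using h_D by (intro nn_integral_cong_AE) auto
  also have "\<dots> = ennreal (2 * pi) * (\<integral>\<^sup>+z'. ennreal (h z') \<partial>lebesgue)"
    using h_meas by (intro nn_integral_cmult) measurable
  finally have "(\<integral>\<^sup>+y. ennreal (u y) \<partial>lebesgue) = ennreal (2 * pi * \<rho>) * (\<integral>\<^sup>+z'. ennreal (h z') \<partial>lebesgue)"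
    using \<open>\<rho> > 0\<close> by (simp add: nn_integral_completion ennreal_mult mult_ac)
  moreover have "AE y in lebesgue. 0 \<le> u y"
    using \<open>\<rho> > 0\<close> by (simp add: u_def)
  moreover have "AE z' in lebesgue. 0 \<le> h z'"
    unfolding AE_completion_iff using h_D by auto
  moreover have "0 < 2 * pi * \<rho>" using \<open>\<rho> > 0\<close> by simp
  ultimately have "(integrable lebesgue u \<longleftrightarrow> integrable lebesgue h)
      \<and> integral\<^sup>L lebesgue u = 2 * pi * \<rho> * integral\<^sup>L lebesgue h"
    by (intro integrable_and_integral_of_nn_integral_eq u_meas h_meas)
  then show ?thesis
    unfolding grav_potential_def set_integrable_def set_lebesgue_integral_def
    by (simp add: u_def[abs_def] h_def[abs_def] I_def)
qed

end
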